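(* Assume $\mathsf{MA}(\sigma\text{-centered})$. Then there exists a countable dense homogeneous subspace $X$ of $2^\omega$ whose complement $2^\omega\setminus X$ is dense in $2^\omega$ and rigid.
   Context: $2^\omega$ is the Cantor set with the product topology. For a space $Z$, $\mathcal{H}(Z)$ denotes the group of homeomorphisms of $Z$ onto itself. A (separable metrizable) space $Z$ is countable dense homogeneous if for every pair $(A,B)$ of countable dense subsets of $Z$ there exists $h\in\mathcal{H}(Z)$ such that $h[A]=B$. A space $Z$ is rigid if $\mathcal{H}(Z)=\{\mathrm{id}\}$. Subsets of $2^\omega$ carry the subspace topology. $\mathsf{MA}(\sigma\text{-centered})$ is Martin's Axiom for $\sigma$-centered posets: for every non-empty $\sigma$-centered poset $\mathbb{P}$ and every collection of fewer than $\mathfrak{c}=2^{\aleph_0}$ dense subsets of $\mathbb{P}$ there is a filter on $\mathbb{P}$ meeting every member of the collection; a poset is $\sigma$-centered if it is a union of countably many subsets, each of which is centered (every finite subset of it has a common lower bound in $\mathbb{P}$). *)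

theory Defs
  imports "HOL-Analysis.Analysis"
begin

definition cantor_space :: "(nat \<Rightarrow> bool) topology" where
  "cantor_space = product_topology (\<lambda>_. discrete_topology UNIV) UNIV"

lemma cantor_space_eq_euclidean: "cantor_space = euclidean"
proof -
  have "discrete_topology (UNIV :: bool set) = euclidean"
    by (rule topology_eq[THEN iffD2]) (simp add: open_discrete)
  then show ?thesis
    by (simp add: cantor_space_def euclidean_product_topology)
qed

definition dense_subset :: "'a topology \<Rightarrow> 'a set \<Rightarrow> bool" where
  "dense_subset Z A \<longleftrightarrow> A \<subseteq> topspace Z \<and> Z closure_of A = topspace Z"

text \<open>
  The next two notions are meant for separable metrizable spaces (in a space that is not
  separable, countable dense homogeneity would be vacuous).  They are only applied to subspaces
  of the Cantor set, all of which are separable and metrizable.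
\<close>

definition countable_dense_homogeneous :: "'a topology \<Rightarrow> bool" where
  "countable_dense_homogeneous Z \<longleftrightarrow>
    (\<forall>A B. countable A \<and> dense_subset Z A \<and> countable B \<and> dense_subset Z B \<longrightarrow>
      (\<exists>h. homeomorphic_map Z Z h \<and> h ` A = B))"

text \<open>
  A homeomorphism is only determined on the points of the space, hence the restriction to
  \<open>topspace Z\<close> in the following definition.
\<close>

definition rigid :: "'a topology \<Rightarrow> bool" where
  "rigid Z \<longleftrightarrow> (\<forall>h. homeomorphic_map Z Z h \<longrightarrow> (\<forall>x\<in>topspace Z. h x = x))"

text \<open>
  A poset is given by its carrier \<open>P\<close> and its order relation \<open>r\<close>;
  \<open>(q, p) \<in> r\<close> stands for \<open>q \<le> p\<close>.
\<close>

definition centered :: "'p set \<Rightarrow> 'p rel \<Rightarrow> 'p set \<Rightarrow> bool" where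
  "centered P r C \<longleftrightarrow>
    C \<subseteq> P \<and> (\<forall>F. finite F \<and> F \<subseteq> C \<longrightarrow> (\<exists>q\<in>P. \<forall>p\<in>F. (q, p) \<in> r))"

definition sigma_centered :: "'p set \<Rightarrow> 'p rel \<Rightarrow> bool" where
  "sigma_centered P r \<longleftrightarrow> (\<exists>C :: nat \<Rightarrow> 'p set. P = (\<Union>n. C n) \<and> (\<forall>n. centered P r (C n)))"

definition poset_dense :: "'p set \<Rightarrow> 'p rel \<Rightarrow> 'p set \<Rightarrow> bool" where
  "poset_dense P r D \<longleftrightarrow> D \<subseteq> P \<and> (\<forall>p\<in>P. \<exists>d\<in>D. (d, p) \<in> r)"

definition poset_filter :: "'p set \<Rightarrow> 'p rel \<Rightarrow> 'p set \<Rightarrow> bool" where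
  "poset_filter P r G \<longleftrightarrow>
    G \<subseteq> P \<and> G \<noteq> {} \<and>
    (\<forall>p\<in>G. \<forall>q\<in>P. (p, q) \<in> r \<longrightarrow> q \<in> G) \<and>
    (\<forall>p\<in>G. \<forall>q\<in>G. \<exists>s\<in>G. (s, p) \<in> r \<and> (s, q) \<in> r)"

text \<open>
  Martin's Axiom quantifies over all posets, that is, over posets whose elements come from an
  arbitrary type.  As one cannot quantify over types inside a formula, the axiom is stated for
  the posets living on a type with continuum many elements.  By a Loewenheim-Skolem argument
  this already yields the axiom for the posets on every type (and for preorders as well); see
  \<open>MA_sigma_centered_preorder\<close> below.
\<close>

definition MA_sigma_centered :: bool where
  "MA_sigma_centered \<longleftrightarrow>
    (\<forall>(P :: (nat \<Rightarrow> bool) set) r \<D>.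
      P \<noteq> {} \<and> partial_order_on P r \<and> sigma_centered P r \<and>
      \<D> \<prec> (UNIV :: (nat \<Rightarrow> bool) set) \<and> (\<forall>D\<in>\<D>. poset_dense P r D) \<longrightarrow>
      (\<exists>G. poset_filter P r G \<and> (\<forall>D\<in>\<D>. G \<inter> D \<noteq> {})))"

unbundle cardinal_syntax

lemma infinite_UNIV_nat_bool: "infinite (UNIV :: (nat \<Rightarrow> bool) set)"
  by (simp add: finite_UNIV_fun)

lemma nat_ordLeq_nat_bool: "|UNIV :: nat set| \<le>o |UNIV :: (nat \<Rightarrow> bool) set|"
  using infinite_UNIV_nat_bool infinite_iff_card_of_nat by blast

lemma finite_subsets_ordLeq:
  assumes "|S :: 'a set| \<le>o |UNIV :: (nat \<Rightarrow> bool) set|"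
  shows "|{F. finite F \<and> F \<subseteq> S}| \<le>o |UNIV :: (nat \<Rightarrow> bool) set|"
proof -
  define K where "K n = {F. finite F \<and> F \<subseteq> S \<and> card F = n}" for n
  have "|K n| \<le>o |UNIV :: (nat \<Rightarrow> bool) set|" for n
  proof (induction n)
    case 0
    have "K 0 = {{}}" by (auto simp: K_def)
    then show ?case
      using infinite_UNIV_nat_bool by (simp add: card_of_singl_ordLeq)
  next
    case (Suc n)
    have "K (Suc n) \<subseteq> (\<Union>x\<in>S. insert x ` K n)"
    proof
      fix F assume "F \<in> K (Suc n)"
      then have F: "finite F" "F \<subseteq> S" "card F = Suc n" by (auto simp: K_def)
      then obtain x G where "F = insert x G" "x \<notin> G" "card G = n" "finite G"
        by (metis card_Suc_eq finite_insert)
      then have "x \<in> S" "G \<in> K n" "F = insert x G"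
        using F by (auto simp: K_def)
      then show "F \<in> (\<Union>x\<in>S. insert x ` K n)" by blast
    qed
    moreover have "|\<Union>x\<in>S. insert x ` K n| \<le>o |UNIV :: (nat \<Rightarrow> bool) set|"
      using infinite_UNIV_nat_bool assms
    proof (rule card_of_UNION_ordLeq_infinite)
      show "\<forall>x\<in>S. |insert x ` K n| \<le>o |UNIV :: (nat \<Rightarrow> bool) set|"
        using Suc.IH card_of_image ordLeq_transitive by blast
    qed
    ultimately show ?case
      using card_of_mono1 ordLeq_transitive by blast
  qed
  then have "|\<Union>n\<in>UNIV. K n| \<le>o |UNIV :: (nat \<Rightarrow> bool) set|"
    using infinite_UNIV_nat_bool nat_ordLeq_nat_bool
    by (intro card_of_UNION_ordLeq_infinite) auto
  moreover have "(\<Union>n\<in>UNIV. K n) = {F. finite F \<and> F \<subseteq> S}"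
    by (auto simp: K_def)
  ultimately show ?thesis by simp
qed

lemma Un_ordLeq_nat_bool:
  assumes "|A :: 'a set| \<le>o |UNIV :: (nat \<Rightarrow> bool) set|" "|B| \<le>o |UNIV :: (nat \<Rightarrow> bool) set|"
  shows "|A \<union> B| \<le>o |UNIV :: (nat \<Rightarrow> bool) set|"
proof -
  have "|UNIV :: bool set| \<le>o |UNIV :: (nat \<Rightarrow> bool) set|"
    by (intro card_of_ordLeq[THEN iffD1] exI[of _ "\<lambda>b _. b"]) (auto simp: inj_on_def fun_eq_iff)
  then have "|\<Union>b\<in>UNIV. if b then A else B| \<le>o |UNIV :: (nat \<Rightarrow> bool) set|"
    using infinite_UNIV_nat_bool assms by (intro card_of_UNION_ordLeq_infinite) auto
  moreover have "(\<Union>b\<in>UNIV. if b then A else B) = A \<union> B"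
    by (auto split: if_splits)
  ultimately show ?thesis by simp
qed

theorem MA_sigma_centered_preorder:
  fixes P :: "'p set"
  assumes MA: "MA_sigma_centered"
    and ne: "P \<noteq> {}" and pre: "preorder_on P r" and sc: "sigma_centered P r"
    and small: "\<D> \<prec> (UNIV :: (nat \<Rightarrow> bool) set)"
    and dense: "\<And>D. D \<in> \<D> \<Longrightarrow> poset_dense P r D"
  shows "\<exists>G. poset_filter P r G \<and> (\<forall>D\<in>\<D>. G \<inter> D \<noteq> {})"
proof -
  have refl: "(p, p) \<in> r" if "p \<in> P" for p
    using pre that by (auto simp: preorder_on_def refl_on_def)
  have tr: "(p, s) \<in> r" if "(p, q) \<in> r" "(q, s) \<in> r" for p q s
    using pre that by (auto simp: preorder_on_def dest: transD)
  have rP: "p \<in> P \<and> q \<in> P" if "(p, q) \<in> r" for p q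
    using pre that by (auto simp: preorder_on_def)
  obtain C :: "nat \<Rightarrow> 'p set" where PC: "P = (\<Union>n. C n)" and cen: "\<And>n. centered P r (C n)"
    using sc by (auto simp: sigma_centered_def)
  obtain p0 where p0: "p0 \<in> P" using ne by blast
  define w where "w D p = (SOME d. d \<in> D \<and> (d, p) \<in> r)" for D p
  have w: "w D p \<in> D \<and> (w D p, p) \<in> r" if "D \<in> \<D>" "p \<in> P" for D p
  proof -
    have "\<exists>d. d \<in> D \<and> (d, p) \<in> r"
      using dense[OF that(1)] that(2) by (auto simp: poset_dense_def)
    then show ?thesis unfolding w_def by (rule someI_ex)
  qed
  define lb where "lb F = (SOME q. q \<in> P \<and> (\<forall>p\<in>F. (q, p) \<in> r))" for F
  have lb: "lb F \<in> P \<and> (\<forall>p\<in>F. (lb F, p) \<in> r)" if "finite F" "F \<subseteq> C n" for F n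
  proof -
    have "\<exists>q. q \<in> P \<and> (\<forall>p\<in>F. (q, p) \<in> r)"
      using cen[of n] that unfolding centered_def by blast
    then show ?thesis unfolding lb_def by (rule someI_ex)
  qed
  define st where "st S = S \<union> ((\<Union>D\<in>\<D>. w D ` S) \<union> lb ` {F. finite F \<and> F \<subseteq> S \<and> (\<exists>n. F \<subseteq> C n)})" for S
  define T where "T k = (st ^^ k) {p0}" for k
  have TS: "T (Suc k) = st (T k)" for k by (simp add: T_def)
  define Q where "Q = (\<Union>k. T k)"
  let ?c = "|UNIV :: (nat \<Rightarrow> bool) set|"
  have Dc: "|\<D>| \<le>o ?c"
    using small by (simp add: lesspoll_def lepoll_def card_of_ordLeq[symmetric])
  have Tc: "|T k| \<le>o ?c" for k
  proof (induction k)
    case 0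
    show ?case
      using infinite_UNIV_nat_bool by (simp add: T_def card_of_singl_ordLeq)
  next
    case (Suc k)
    have a: "|\<Union>D\<in>\<D>. w D ` T k| \<le>o ?c"
      using infinite_UNIV_nat_bool Dc
    proof (rule card_of_UNION_ordLeq_infinite)
      show "\<forall>D\<in>\<D>. |w D ` T k| \<le>o ?c"
        using Suc.IH card_of_image ordLeq_transitive by blast
    qed
    have "|{F. finite F \<and> F \<subseteq> T k \<and> (\<exists>n. F \<subseteq> C n)}| \<le>o |{F. finite F \<and> F \<subseteq> T k}|"
      by (rule card_of_mono1) auto
    then have "|lb ` {F. finite F \<and> F \<subseteq> T k \<and> (\<exists>n. F \<subseteq> C n)}| \<le>o ?c"
      by (rule ordLeq_transitive[OF card_of_image ordLeq_transitive])
        (rule finite_subsets_ordLeq[OF Suc.IH])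
    then show ?case
      unfolding TS st_def using a Suc.IH by (intro Un_ordLeq_nat_bool)
  qed
  have Qc: "|Q| \<le>o ?c"
    unfolding Q_def using infinite_UNIV_nat_bool nat_ordLeq_nat_bool Tc
    by (intro card_of_UNION_ordLeq_infinite) auto
  have TP: "T k \<subseteq> P" for k
  proof (induction k)
    case 0 show ?case using p0 by (simp add: T_def)
  next
    case (Suc k)
    have "w D p \<in> P" if "D \<in> \<D>" "p \<in> T k" for D p
      using w[OF that(1)] Suc.IH that(2) rP by blast
    then show ?case
      unfolding TS st_def using Suc.IH lb by auto
  qed
  have QP: "Q \<subseteq> P" using TP by (auto simp: Q_def)
  have p0Q: "p0 \<in> Q"
    unfolding Q_def by (rule UN_I[of 0]) (auto simp: T_def)
  have Tmono: "T j \<subseteq> T k" if "j \<le> k" for j k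
    using that by (rule lift_Suc_mono_le[rotated]) (auto simp: TS st_def)
  have wQ: "w D p \<in> Q" if "D \<in> \<D>" "p \<in> Q" for D p
  proof -
    from that(2) obtain k where "p \<in> T k" by (auto simp: Q_def)
    then have "w D p \<in> T (Suc k)" using that(1) by (auto simp: TS st_def)
    then show ?thesis by (auto simp: Q_def)
  qed
  have lbQ: "lb F \<in> Q" if "finite F" "F \<subseteq> Q" "F \<subseteq> C n" for F n
  proof -
    have "\<exists>k. F \<subseteq> T k" using that(1,2)
    proof (induction F)
      case (insert x F)
      then obtain j k where "F \<subseteq> T k" "x \<in> T j" by (auto simp: Q_def)
      then have "insert x F \<subseteq> T (max j k)"
        using Tmono[of j "max j k"] Tmono[of k "max j k"] by auto
      then show ?case by blast
    qed auto
    then obtain k where "F \<subseteq> T k" by blast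
    then have "lb F \<in> T (Suc k)" using that unfolding TS st_def by blast
    then show ?thesis by (auto simp: Q_def)
  qed
  obtain g :: "'p \<Rightarrow> nat \<Rightarrow> bool" where g: "inj_on g Q"
    using Qc by (auto simp: card_of_ordLeq[symmetric])
  define rep where "rep x = (SOME y. y \<in> Q \<and> (x, y) \<in> r \<and> (y, x) \<in> r)" for x
  have rep: "rep x \<in> Q \<and> (x, rep x) \<in> r \<and> (rep x, x) \<in> r" if "x \<in> Q" for x
  proof -
    have "\<exists>y. y \<in> Q \<and> (x, y) \<in> r \<and> (y, x) \<in> r"
      using that refl QP by blast
    then show ?thesis unfolding rep_def by (rule someI_ex)
  qed
  have rep_eq: "rep x = rep y" if "(x, y) \<in> r" "(y, x) \<in> r" for x y
  proof -
    have "(z \<in> Q \<and> (x, z) \<in> r \<and> (z, x) \<in> r) = (z \<in> Q \<and> (y, z) \<in> r \<and> (z, y) \<in> r)" for z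
      using that tr by blast
    then show ?thesis by (simp add: rep_def)
  qed
  define f where "f x = g (rep x)" for x
  have f_eq: "f x = f y \<longleftrightarrow> (x, y) \<in> r \<and> (y, x) \<in> r" if "x \<in> Q" "y \<in> Q" for x y
  proof
    assume "f x = f y"
    then have "rep x = rep y" using g rep that by (auto simp: f_def dest: inj_onD)
    then show "(x, y) \<in> r \<and> (y, x) \<in> r" using rep that tr by metis
  qed (auto simp: f_def dest: rep_eq)
  define r' where "r' = {(f x, f y) |x y. x \<in> Q \<and> y \<in> Q \<and> (x, y) \<in> r}"
  have r': "(f x, f y) \<in> r' \<longleftrightarrow> (x, y) \<in> r" if xy: "x \<in> Q" "y \<in> Q" for x y
  proof
    assume "(f x, f y) \<in> r'"
    then obtain a b where "f x = f a" "f y = f b" "a \<in> Q" "b \<in> Q" "(a, b) \<in> r"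
      by (auto simp: r'_def)
    then have "(x, a) \<in> r" "(a, b) \<in> r" "(b, y) \<in> r" using f_eq xy by auto
    then show "(x, y) \<in> r" using tr by blast
  qed (use xy in \<open>auto simp: r'_def\<close>)
  have "\<exists>G. poset_filter (f ` Q) r' G \<and> (\<forall>D\<in>(\<lambda>D. f ` (D \<inter> Q)) ` \<D>. G \<inter> D \<noteq> {})"
  proof (rule MA[unfolded MA_sigma_centered_def, rule_format], intro conjI ballI)
    show "f ` Q \<noteq> {}" using p0Q by blast
    show "partial_order_on (f ` Q) r'"
      unfolding partial_order_on_def preorder_on_def
    proof (intro conjI)
      show "r' \<subseteq> f ` Q \<times> f ` Q" by (auto simp: r'_def)
      show "refl_on (f ` Q) r'" using r' refl QP by (auto simp: refl_on_def)
      show "trans r'"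
      proof (rule transI)
        fix a b c assume "(a, b) \<in> r'" "(b, c) \<in> r'"
        then obtain x y z where "a = f x" "b = f y" "c = f z" "x \<in> Q" "y \<in> Q" "z \<in> Q"
          by (auto simp: r'_def)
        then show "(a, c) \<in> r'" using \<open>(a, b) \<in> r'\<close> \<open>(b, c) \<in> r'\<close> r' tr by metis
      qed
      show "antisym r'"
      proof (rule antisymI)
        fix a b assume "(a, b) \<in> r'" "(b, a) \<in> r'"
        then obtain x y where "a = f x" "b = f y" "x \<in> Q" "y \<in> Q"
          by (auto simp: r'_def)
        then show "a = b" using \<open>(a, b) \<in> r'\<close> \<open>(b, a) \<in> r'\<close> r' f_eq by metis
      qed
    qed
    show "sigma_centered (f ` Q) r'"
      unfolding sigma_centered_def
    proof (intro exI conjI allI)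
      show "f ` Q = (\<Union>n. f ` (Q \<inter> C n))" using QP PC by blast
      fix n
      show "centered (f ` Q) r' (f ` (Q \<inter> C n))"
        unfolding centered_def
      proof (intro conjI allI impI)
        fix F assume "finite F \<and> F \<subseteq> f ` (Q \<inter> C n)"
        then obtain E where E: "E \<subseteq> Q \<inter> C n" "finite E" "F = f ` E"
          by (meson finite_subset_image)
        then have "lb E \<in> Q" "\<forall>p\<in>E. (lb E, p) \<in> r" using lbQ lb[of E n] by auto
        then show "\<exists>q\<in>f ` Q. \<forall>p\<in>F. (q, p) \<in> r'"
          using E r' by blast
      qed auto
    qed
    show "(\<lambda>D. f ` (D \<inter> Q)) ` \<D> \<prec> (UNIV :: (nat \<Rightarrow> bool) set)"
      using small image_lepoll lesspoll_trans1 by blast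
  next
    fix D' assume "D' \<in> (\<lambda>D. f ` (D \<inter> Q)) ` \<D>"
    then obtain D where D: "D \<in> \<D>" "D' = f ` (D \<inter> Q)" by blast
    show "poset_dense (f ` Q) r' D'"
      unfolding poset_dense_def
    proof (intro conjI ballI)
      fix a assume "a \<in> f ` Q"
      then obtain x where "a = f x" "x \<in> Q" by blast
      then show "\<exists>d\<in>D'. (d, a) \<in> r'"
        using w[OF D(1), of x] wQ[OF D(1), of x] QP r' D(2) by blast
    qed (use D in auto)
  qed
  then obtain G' where G': "poset_filter (f ` Q) r' G'"
    and meet: "\<And>D. D \<in> \<D> \<Longrightarrow> G' \<inter> f ` (D \<inter> Q) \<noteq> {}" by auto
  define G where "G = {p \<in> P. \<exists>x\<in>Q. f x \<in> G' \<and> (x, p) \<in> r}"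
  have "poset_filter P r G"
    unfolding poset_filter_def
  proof (intro conjI ballI impI)
    show "G \<subseteq> P" by (auto simp: G_def)
    obtain x where "x \<in> Q" "f x \<in> G'" using G' unfolding poset_filter_def by blast
    then show "G \<noteq> {}" using QP refl by (auto simp: G_def)
    fix p q assume "p \<in> G" "q \<in> P" "(p, q) \<in> r"
    then show "q \<in> G" using tr by (auto simp: G_def)
  next
    fix p q assume "p \<in> G" "q \<in> G"
    then obtain x y where xy: "x \<in> Q" "f x \<in> G'" "(x, p) \<in> r" "y \<in> Q" "f y \<in> G'" "(y, q) \<in> r"
      by (auto simp: G_def)
    then obtain s where "s \<in> G'" "(s, f x) \<in> r'" "(s, f y) \<in> r'"
      using G' unfolding poset_filter_def by blast
    moreover then obtain z where "z \<in> Q" "s = f z" using G' unfolding poset_filter_def by blast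
    ultimately have "z \<in> Q" "f z \<in> G'" "(z, x) \<in> r" "(z, y) \<in> r" using r' xy by auto
    have "z \<in> P" using \<open>z \<in> Q\<close> QP by blast
    then have "z \<in> G"
      using \<open>z \<in> Q\<close> \<open>f z \<in> G'\<close> refl unfolding G_def by blast
    moreover have "(z, p) \<in> r" "(z, q) \<in> r"
      using tr[OF \<open>(z, x) \<in> r\<close> xy(3)] tr[OF \<open>(z, y) \<in> r\<close> xy(6)] by auto
    ultimately show "\<exists>s\<in>G. (s, p) \<in> r \<and> (s, q) \<in> r" by blast
  qed
  moreover have "G \<inter> D \<noteq> {}" if "D \<in> \<D>" for D
    using meet[OF that] QP refl by (auto simp: G_def)
  ultimately show ?thesis by blast
qed

unbundle no cardinal_syntax

end

theory Submission
  imports Defs "HOL-Library.Function_Algebras"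
begin

text \<open>
  Homogeneity asks for many homeomorphisms of \<open>X\<close>, and rigidity of the complement \<open>Y\<close>
  forbids every one of them (except the identity) to extend to a homeomorphism of the Cantor set.
  The homeomorphisms of \<open>X\<close> are therefore built from maps with discontinuities that lie in \<open>Y\<close>.
  The Cantor set is regarded as a compactification of \<open>\<int>\<^sup>\<omega>\<close>: an embedding \<open>code\<close> of
  \<open>\<int>\<^sup>\<omega>\<close> misses a countable dense set of \<open>ends\<close>, and the coding is arranged so
  that translation by a sequence with infinitely many nonzero terms is discontinuous at some end in
  every open set.  The translations by elements of a countable dense group \<open>shifts\<close> of such
  sequences (and of \<open>0\<close>) are the building blocks, and \<open>X\<close> is the image under \<open>code\<close>
  of a set that is invariant under them.

  Martin's Axiom enters only through the fact that fewer than continuum many functions on the natural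
  numbers are eventually bounded by a single one (\<open>MA_imp_eventually_bounded\<close>).  This permits
  a recursion of length continuum (\<open>ex_invariant_scale\<close>) in which each newly chosen orbit of
  \<open>shifts\<close> eventually exceeds the functions prescribed at this stage and at the earlier ones.
  Then \<open>X\<close> is a \<open>\<lambda>\<close>-set: the complement in \<open>X\<close> of a countable set \<open>E\<close> is covered by
  countably many closed sets that miss \<open>E\<close> (\<open>closed_cover\<close>).

  For homogeneity let \<open>A\<close> and \<open>B\<close> be countable dense subsets of \<open>X\<close>, contained in
  a countable invariant \<open>E \<subseteq> X\<close>.  A back-and-forth construction
  (\<open>back_and_forth.ex_displacement\<close>) yields a homeomorphism that maps \<open>A\<close> onto \<open>B\<close>
  and \<open>E\<close> onto \<open>E\<close>, while each point of \<open>X - E\<close> is only moved within its orbit: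
  at step \<open>n\<close> one stays away from the \<open>n\<close>-th closed set.  Hence \<open>X\<close> is mapped onto
  itself.

  For rigidity let \<open>h\<close> be a homeomorphism of \<open>Y\<close>, not the identity.  As the ends are dense
  and lie in \<open>Y\<close>, \<open>h\<close> is determined by its values there, so that there are only
  continuum many candidates and each is treated at some stage.  That stage selects a new point
  \<open>z\<close> of a region that \<open>h\<close> displaces, and decides either that \<open>code z\<close> is
  in \<open>X\<close> and the limit of \<open>h\<close> there is not, or that \<open>code z\<close> is not in \<open>X\<close>
  and the limit of \<open>h\<close> there, if it exists, is; neither is compatible with \<open>h\<close> being a
  homeomorphism of \<open>Y\<close>.  This is impossible only if \<open>h\<close> moves all the available \<open>z\<close>
  within their orbits; by a Baire category argument it is then a fixed nonzero translation on a
  large set of \<open>z\<close>, so that it inherits a discontinuity at some end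
  (\<open>ex_not_translation\<close>).
\<close>

section \<open>Common initial segments\<close>

definition agree :: "nat \<Rightarrow> (nat \<Rightarrow> 'a) \<Rightarrow> (nat \<Rightarrow> 'a) \<Rightarrow> bool" where
  "agree n x y \<longleftrightarrow> (\<forall>i<n. x i = y i)"

lemma agree_refl [simp]: "agree n x x"
  by (simp add: agree_def)

lemma agree_sym: "agree n x y \<longleftrightarrow> agree n y x"
  by (auto simp: agree_def)

lemma agree_trans [trans]: "agree n x y \<Longrightarrow> agree n y z \<Longrightarrow> agree n x z"
  by (simp add: agree_def)

lemma agree_mono: "agree n x y \<Longrightarrow> m \<le> n \<Longrightarrow> agree m x y"
  by (simp add: agree_def)

lemma agree_add:
  fixes x y u v :: "nat \<Rightarrow> int"
  shows "agree n x y \<Longrightarrow> agree n u v \<Longrightarrow> agree n (x + u) (y + v)"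
  by (simp add: agree_def)

lemma not_agree_ex: "x \<noteq> y \<Longrightarrow> \<exists>n. \<not> agree n x y"
  by (auto simp: agree_def fun_eq_iff)

section \<open>The topology of the Cantor set in terms of initial segments\<close>

lemma topspace_cantor_space [simp]: "topspace cantor_space = UNIV"
  by (simp add: cantor_space_def PiE_UNIV_domain)

lemma openin_cantor_space_iff:
  "openin cantor_space U \<longleftrightarrow> (\<forall>x\<in>U. \<exists>n. \<forall>y. agree n x y \<longrightarrow> y \<in> U)"
proof
  assume U: "openin cantor_space U"
  show "\<forall>x\<in>U. \<exists>n. \<forall>y. agree n x y \<longrightarrow> y \<in> U"
  proof
    fix x assume "x \<in> U"
    then obtain V where V: "finite {i. V i \<noteq> (UNIV :: bool set)}" "x \<in> Pi\<^sub>E UNIV V" "Pi\<^sub>E UNIV V \<subseteq> U"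
      using U unfolding cantor_space_def openin_product_topology_alt by fastforce
    obtain n where n: "\<And>i. V i \<noteq> UNIV \<Longrightarrow> i < n"
      using V(1) by (metis (mono_tags, lifting) finite_nat_set_iff_bounded mem_Collect_eq)
    have "y \<in> U" if "agree n x y" for y
    proof -
      have "y i \<in> V i" for i
      proof (cases "V i = UNIV")
        case False
        then have "y i = x i" using that n by (simp add: agree_def)
        then show ?thesis using PiE_mem[OF V(2) UNIV_I, of i] by simp
      qed simp
      then show ?thesis using V(3) by (auto simp: PiE_UNIV_domain)
    qed
    then show "\<exists>n. \<forall>y. agree n x y \<longrightarrow> y \<in> U" by blast
  qed
next
  assume U: "\<forall>x\<in>U. \<exists>n. \<forall>y. agree n x y \<longrightarrow> y \<in> U"
  show "openin cantor_space U"
    unfolding cantor_space_def openin_product_topology_alt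
  proof (intro conjI ballI)
    fix x assume "x \<in> U"
    then obtain n where n: "\<And>y. agree n x y \<Longrightarrow> y \<in> U" using U by blast
    define V where "V i = (if i < n then {x i} else UNIV)" for i
    have "{i \<in> UNIV. V i \<noteq> topspace (discrete_topology UNIV)} \<subseteq> {..<n}"
      by (auto simp: V_def)
    then have "finite {i \<in> UNIV. V i \<noteq> topspace (discrete_topology UNIV)}"
      using finite_subset by blast
    moreover have "Pi\<^sub>E UNIV V \<subseteq> U"
      by (rule subsetI, rule n) (auto simp: agree_def V_def PiE_UNIV_domain Pi_iff split: if_splits)
    ultimately show "\<exists>V. finite {i \<in> UNIV. V i \<noteq> topspace (discrete_topology UNIV)} \<and>
        (\<forall>i\<in>UNIV. openin (discrete_topology UNIV) (V i)) \<and> x \<in> Pi\<^sub>E UNIV V \<and> Pi\<^sub>E UNIV V \<subseteq> U"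
      by (intro exI[of _ V]) (auto simp: V_def PiE_UNIV_domain)
  qed
qed

lemma openin_cylinder: "openin cantor_space {y. agree n x y}"
  unfolding openin_cantor_space_iff using agree_trans by blast

lemma continuous_map_cantor_iff:
  "continuous_map (subtopology cantor_space X) (subtopology cantor_space Y) h \<longleftrightarrow>
    h ` X \<subseteq> Y \<and> (\<forall>x\<in>X. \<forall>n. \<exists>m. \<forall>x'\<in>X. agree m x x' \<longrightarrow> agree n (h x) (h x'))"
  (is "?L \<longleftrightarrow> ?R")
proof
  assume L: ?L
  have "\<exists>m. \<forall>x'\<in>X. agree m x x' \<longrightarrow> agree n (h x) (h x')" if "x \<in> X" for x n
  proof -
    have "openin (subtopology cantor_space X) {x' \<in> X. h x' \<in> {y. agree n (h x) y}}"
      using openin_continuous_map_preimage[OF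
          continuous_map_into_fulltopology[OF L] openin_cylinder] by simp
    then obtain T where T: "openin cantor_space T" "{x' \<in> X. h x' \<in> {y. agree n (h x) y}} = T \<inter> X"
      unfolding openin_subtopology by blast
    have "x \<in> T \<inter> X" unfolding T(2)[symmetric] using that by simp
    then obtain m where m: "\<forall>y. agree m x y \<longrightarrow> y \<in> T"
      using T(1) unfolding openin_cantor_space_iff by (meson IntD1)
    have "agree n (h x) (h x')" if "x' \<in> X" "agree m x x'" for x'
    proof -
      have "x' \<in> T \<inter> X" using that m by simp
      then show ?thesis unfolding T(2)[symmetric] by simp
    qed
    then show ?thesis by blast
  qed
  then show ?R using L by (auto simp: continuous_map_in_subtopology)
next
  assume R: ?R
  have "openin (subtopology cantor_space X) {x \<in> X. h x \<in> U}" if U: "openin cantor_space U" for U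
  proof (subst openin_subopen, intro ballI)
    fix x assume x: "x \<in> {x \<in> X. h x \<in> U}"
    then obtain n where n: "\<And>y. agree n (h x) y \<Longrightarrow> y \<in> U"
      using U unfolding openin_cantor_space_iff by blast
    obtain m where m: "\<And>x'. x' \<in> X \<Longrightarrow> agree m x x' \<Longrightarrow> agree n (h x) (h x')"
      using conjunct2[OF R] x by (metis (no_types, lifting) mem_Collect_eq)
    show "\<exists>T. openin (subtopology cantor_space X) T \<and> x \<in> T \<and> T \<subseteq> {x \<in> X. h x \<in> U}"
      by (intro exI[of _ "X \<inter> {y. agree m x y}"] conjI openin_subtopology_Int2 openin_cylinder)
        (use x n m in auto)
  qed
  then have "continuous_map (subtopology cantor_space X) cantor_space h"
    by (simp add: continuous_map_def)
  then show ?L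
    using R by (simp add: continuous_map_in_subtopology image_subset_iff_funcset)
qed

text \<open>
  The two lemmas below are the only interface to the topological notions; from here on, spaces
  and maps are handled through initial segments.
\<close>

lemma homeomorphic_map_cantorI:
  assumes img: "h ` X = Y" and inj: "inj_on h X"
    and cont: "\<And>x n. x \<in> X \<Longrightarrow> \<exists>m. \<forall>x'\<in>X. agree m x x' \<longrightarrow> agree n (h x) (h x')"
    and inv: "\<And>x n. x \<in> X \<Longrightarrow> \<exists>m. \<forall>x'\<in>X. agree m (h x) (h x') \<longrightarrow> agree n x x'"
  shows "homeomorphic_map (subtopology cantor_space X) (subtopology cantor_space Y) h"
proof -
  have "homeomorphic_maps (subtopology cantor_space X) (subtopology cantor_space Y) h (inv_into X h)"
    unfolding homeomorphic_maps_def continuous_map_cantor_iff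
    using img inj cont inv by (auto simp: inv_into_f_f)
  then show ?thesis using homeomorphic_map_maps by blast
qed

lemma homeomorphic_map_cantorD:
  assumes "homeomorphic_map (subtopology cantor_space X) (subtopology cantor_space Y) h"
  shows "h ` X = Y" "inj_on h X"
    "\<And>x n. x \<in> X \<Longrightarrow> \<exists>m. \<forall>x'\<in>X. agree m x x' \<longrightarrow> agree n (h x) (h x')"
    "\<And>x n. x \<in> X \<Longrightarrow> \<exists>m. \<forall>x'\<in>X. agree m (h x) (h x') \<longrightarrow> agree n x x'"
proof -
  obtain g where "homeomorphic_maps (subtopology cantor_space X) (subtopology cantor_space Y) h g"
    using assms homeomorphic_map_maps by blast
  then have ch: "continuous_map (subtopology cantor_space X) (subtopology cantor_space Y) h"
    and cg: "continuous_map (subtopology cantor_space Y) (subtopology cantor_space X) g"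
    and gh: "\<And>x. x \<in> X \<Longrightarrow> g (h x) = x" and hg: "\<And>y. y \<in> Y \<Longrightarrow> h (g y) = y"
    by (auto simp: homeomorphic_maps_def)
  note c = ch[unfolded continuous_map_cantor_iff] cg[unfolded continuous_map_cantor_iff]
  show "h ` X = Y"
  proof
    show "Y \<subseteq> h ` X"
    proof
      fix y assume "y \<in> Y"
      then have "g y \<in> X" "h (g y) = y" using c hg by auto
      then show "y \<in> h ` X" by (metis imageI)
    qed
  qed (use c in auto)
  show "inj_on h X" using gh by (metis inj_onI)
  show "\<exists>m. \<forall>x'\<in>X. agree m x x' \<longrightarrow> agree n (h x) (h x')" if "x \<in> X" for x n
    using conjunct2[OF c(1)] that by simp
  show "\<exists>m. \<forall>x'\<in>X. agree m (h x) (h x') \<longrightarrow> agree n x x'" if x: "x \<in> X" for x n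
  proof -
    have "h x \<in> Y" using c(1) x by auto
    then obtain m where m: "\<forall>y\<in>Y. agree m (h x) y \<longrightarrow> agree n (g (h x)) (g y)"
      using bspec[OF conjunct2[OF c(2)], of "h x"] by blast
    have "agree n x x'" if "x' \<in> X" "agree m (h x) (h x')" for x'
    proof -
      have "h x' \<in> Y" using c(1) that(1) by auto
      then have "agree n (g (h x)) (g (h x'))" using m that by blast
      then show ?thesis using gh x that by simp
    qed
    then show ?thesis by blast
  qed
qed

lemma dense_subset_cantor_iff:
  "dense_subset (subtopology cantor_space X) A \<longleftrightarrow> A \<subseteq> X \<and> (\<forall>x\<in>X. \<forall>n. \<exists>a\<in>A. agree n x a)"
proof -
  have "subtopology cantor_space X closure_of A = X \<longleftrightarrow> (\<forall>x\<in>X. \<forall>n. \<exists>a\<in>A. agree n x a)"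
    if A: "A \<subseteq> X"
  proof -
    have "subtopology cantor_space X closure_of A = X \<inter> cantor_space closure_of A"
      using A by (simp add: closure_of_subtopology Int_absorb1)
    moreover have "cantor_space closure_of A = {x. \<forall>n. \<exists>a\<in>A. agree n x a}"
    proof (intro set_eqI iffI)
      fix x assume x: "x \<in> cantor_space closure_of A"
      have "\<exists>a\<in>A. agree n x a" for n
      proof -
        have "x \<in> {y. agree n x y}" by simp
        then obtain a where "a \<in> A" "a \<in> {y. agree n x y}"
          using x openin_cylinder[of n x] unfolding in_closure_of by meson
        then show ?thesis by blast
      qed
      then show "x \<in> {x. \<forall>n. \<exists>a\<in>A. agree n x a}" by simp
    next
      fix x assume x: "x \<in> {x. \<forall>n. \<exists>a\<in>A. agree n x a}"
      have "\<exists>a\<in>A. a \<in> U" if U: "x \<in> U" "openin cantor_space U" for U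
      proof -
        obtain n where n: "\<forall>y. agree n x y \<longrightarrow> y \<in> U"
          using U unfolding openin_cantor_space_iff by meson
        obtain a where "a \<in> A" "agree n x a" using x by blast
        then show ?thesis using n by blast
      qed
      then show "x \<in> cantor_space closure_of A"
        unfolding in_closure_of by (simp; blast)
    qed
    ultimately have "subtopology cantor_space X closure_of A = X \<inter> {x. \<forall>n. \<exists>a\<in>A. agree n x a}"
      by simp
    then show ?thesis by (simp only: inf.absorb_iff1[symmetric] subset_eq mem_Collect_eq)
  qed
  then show ?thesis
    unfolding dense_subset_def topspace_subtopology topspace_cantor_space Int_UNIV_left by blast
qed

section \<open>A countable dense group of translations of \<open>\<int>\<^sup>\<omega>\<close>\<close>

text \<open>
  The map \<open>\<lambda>n. fst (prod_decode n)\<close> takes every value infinitely often and lowers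
  every positive argument.  An element of \<open>shifts\<close> is eventually invariant under composition
  with it.  Hence its tail is computed from a finite initial segment, which may be prescribed (so
  the group is countable and dense), and a nonzero term recurs infinitely often.
\<close>

definition shifts :: "(nat \<Rightarrow> int) set" where
  "shifts = {u. \<exists>N. \<forall>n\<ge>N. u n = u (fst (prod_decode n))}"

lemma fst_prod_decode_less: "n > 0 \<Longrightarrow> fst (prod_decode n) < n"
proof -
  assume "n > 0"
  obtain a b where ab: "prod_decode n = (a, b)" by fastforce
  then have n: "n = prod_encode (a, b)" by (metis prod_decode_inverse)
  have "a < n"
  proof (cases "a + b = 0")
    case True then show ?thesis using \<open>n > 0\<close> by simp
  next
    case False
    then obtain k where "a + b = Suc k" using not0_implies_Suc by blast
    then have "triangle (a + b) > 0" by simp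
    then show ?thesis by (simp add: n prod_encode_def)
  qed
  then show ?thesis by (simp add: ab)
qed

lemma shifts_zero: "0 \<in> shifts"
  by (auto simp: shifts_def)

lemma shifts_add: "u \<in> shifts \<Longrightarrow> v \<in> shifts \<Longrightarrow> u + v \<in> shifts"
proof -
  assume "u \<in> shifts" "v \<in> shifts"
  then obtain M N where M: "\<forall>n\<ge>M. u n = u (fst (prod_decode n))"
    and N: "\<forall>n\<ge>N. v n = v (fst (prod_decode n))"
    by (auto simp: shifts_def)
  then have "\<forall>n\<ge>max M N. (u + v) n = (u + v) (fst (prod_decode n))" by simp
  then show ?thesis unfolding shifts_def by blast
qed

lemma shifts_uminus: "u \<in> shifts \<Longrightarrow> - u \<in> shifts"
  by (auto simp: shifts_def)

lemma shifts_nonzero_infinitely_often: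
  assumes u: "u \<in> shifts" and i: "u i \<noteq> 0"
  shows "\<exists>n\<ge>m. u n \<noteq> 0"
proof -
  obtain N where N: "\<And>n. n \<ge> N \<Longrightarrow> u n = u (fst (prod_decode n))"
    using u by (auto simp: shifts_def)
  \<comment> \<open>one of the infinitely many indices that the invariance relates to \<open>i\<close>\<close>
  define n where "n = prod_encode (i, max m N)"
  have "n \<ge> max m N" unfolding n_def by (rule le_prod_encode_2)
  then have "n \<ge> m" "u n = u i" using N by (auto simp: n_def)
  then show ?thesis using i by auto
qed

lemma shifts_dense: "\<exists>u\<in>shifts. agree m x u"
proof (induction m)
  case 0
  show ?case using shifts_zero by (auto simp: agree_def)
next
  case (Suc m)
  have *: "\<exists>u. agree (Suc m) x u \<and> (\<forall>n\<ge>Suc m. u n = u (fst (prod_decode n)))"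
  proof -
    have "\<exists>u. \<forall>n. u n = (if n \<le> m then x n else u (fst (prod_decode n)))"
    proof -
      have "\<exists>f. \<forall>n. (f n :: int) = (if n \<le> m then x n else f (fst (prod_decode n)))"
        by (rule dependent_wf_choice[where R = less_than and
              P = "\<lambda>f n r. r = (if n \<le> m then x n else f (fst (prod_decode n)))"])
          (auto simp: fst_prod_decode_less)
      then show ?thesis by blast
    qed
    then obtain u where "\<And>n. u n = (if n \<le> m then x n else u (fst (prod_decode n)))" by blast
    then have "agree (Suc m) x u" "\<forall>n\<ge>Suc m. u n = u (fst (prod_decode n))"
      by (auto simp: agree_def)
    then show ?thesis by blast
  qed
  then show ?case unfolding shifts_def by blast
qed

lemma countable_shifts: "countable shifts"
proof -
  define T where "T N = {u :: nat \<Rightarrow> int. \<forall>n\<ge>N. u n = u (fst (prod_decode n))}" for N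
  have "countable (T N)" if "N > 0" for N
  proof -
    have "inj_on (\<lambda>u. map u [0..<N]) (T N)"
    proof (rule inj_onI)
      fix u v assume u: "u \<in> T N" and v: "v \<in> T N" and uv: "map u [0..<N] = map v [0..<N]"
      have "u n = v n" for n
      proof (induction n rule: less_induct)
        case (less n)
        show ?case
        proof (cases "n < N")
          case True
          then show ?thesis using uv by auto
        next
          case False
          then have "fst (prod_decode n) < n" using that by (intro fst_prod_decode_less) simp
          then show ?thesis using less u v False by (simp add: T_def)
        qed
      qed
      then show "u = v" by (rule ext)
    qed
    then show ?thesis by (rule countable_image_inj_on[OF countableI_type])
  qed
  moreover have "shifts \<subseteq> (\<Union>N. T (Suc N))"
    unfolding shifts_def T_def using Suc_leD by blast
  ultimately show ?thesis by (meson countable_UN countable_subset countableI_type zero_less_Suc)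
qed

section \<open>Coding sequences of integers by points of the Cantor set\<close>

text \<open>
  The integers are split into two infinite classes such that no nonzero translation respects the
  splitting near infinity: there are integers of arbitrarily large modulus outside \<open>spikes\<close> that
  it leaves outside, and others that it moves inside.  Any infinite set with gaps that tend to
  infinity would do; powers of two are convenient.
\<close>

definition spikes :: "int set" where
  "spikes = range (\<lambda>k. 2 ^ k)"

lemma infinite_spikes: "infinite spikes"
proof -
  have "inj (\<lambda>k. 2 ^ k :: int)" by (rule injI) simp
  then show ?thesis unfolding spikes_def by (rule range_inj_infinite)
qed

lemma nonpos_not_spike: "c \<le> 0 \<Longrightarrow> c \<notin> spikes"
  by (auto simp: spikes_def not_le)

lemma infinite_not_spikes: "infinite (- spikes)"
proof
  assume "finite (- spikes)"
  moreover have "{..0::int} \<subseteq> - spikes" using nonpos_not_spike by blast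
  ultimately have "finite {..0::int}" using finite_subset by blast
  then show False by (simp add: infinite_Iic)
qed

lemma not_spike_shift_not_spike: "\<exists>q. \<bar>q\<bar> \<ge> B \<and> q \<notin> spikes \<and> q + c \<notin> spikes"
  by (intro exI[of _ "- \<bar>B\<bar> - \<bar>c\<bar>"]) (auto intro!: nonpos_not_spike)

lemma not_spike_shift_spike:
  assumes "c \<noteq> 0"
  shows "\<exists>q. \<bar>q\<bar> \<ge> B \<and> q \<notin> spikes \<and> q + c \<in> spikes"
proof -
  define k where "k = nat (\<bar>B\<bar> + \<bar>c\<bar>)"
  have k: "\<bar>B\<bar> + \<bar>c\<bar> < 2 ^ k"
    using less_exp[of k] unfolding k_def by (metis abs_ge_zero add_nonneg_nonneg int_nat_eq of_nat_less_numeral_power_cancel_iff)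
  \<comment> \<open>\<open>2 ^ Suc k\<close> differs from every other power of two by at least \<open>2 ^ k\<close>, so that \<open>q\<close> is not a power of two itself\<close>
  define q where "q = 2 ^ Suc k - c"
  have "q \<notin> spikes"
  proof
    assume "q \<in> spikes"
    then obtain j where j: "2 ^ Suc k - c = 2 ^ j" by (auto simp: q_def spikes_def)
    have "j \<noteq> Suc k" using j assms by auto
    then consider "j \<le> k" | "Suc (Suc k) \<le> j" by linarith
    then show False
    proof cases
      case 1
      then have "(2::int) ^ j \<le> 2 ^ k" by simp
      then show False using j k unfolding power_Suc by linarith
    next
      case 2
      then have "(2::int) ^ Suc (Suc k) \<le> 2 ^ j" by (intro power_increasing) auto
      then show False using j k unfolding power_Suc by linarith
    qed
  qed
  moreover have "\<bar>q\<bar> \<ge> B" using k unfolding q_def by simp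
  moreover have "q + c \<in> spikes"
    unfolding q_def spikes_def by (intro image_eqI[of _ _ "Suc k"]) auto
  ultimately show ?thesis by blast
qed

definition run_length :: "int \<Rightarrow> nat" where
  "run_length c = (if c \<in> spikes then to_nat_on spikes c else to_nat_on (- spikes) c)"

lemma run_length_inj: "c \<in> spikes \<longleftrightarrow> d \<in> spikes \<Longrightarrow> run_length c = run_length d \<Longrightarrow> c = d"
  by (auto simp: run_length_def split: if_splits)

lemma run_length_surj: "\<exists>c. (c \<in> spikes \<longleftrightarrow> b) \<and> run_length c = i"
proof (cases b)
  case True
  have "i \<in> to_nat_on spikes ` spikes"
    using to_nat_on_infinite[OF _ infinite_spikes] by (simp add: bij_betw_def)
  then show ?thesis using True by (auto simp: run_length_def)
next
  case False
  have "i \<in> to_nat_on (- spikes) ` (- spikes)"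
    using to_nat_on_infinite[OF _ infinite_not_spikes] by (simp add: bij_betw_def)
  then show ?thesis using False by (auto simp: run_length_def)
qed

lemma run_length_tendsto: "\<exists>B. \<forall>c. \<bar>c\<bar> \<ge> B \<longrightarrow> run_length c \<ge> M"
proof -
  have "finite {c. run_length c < M}"
  proof -
    have "inj_on (\<lambda>c. (c \<in> spikes, run_length c)) {c. run_length c < M}"
      by (rule inj_onI) (auto intro: run_length_inj)
    moreover have "(\<lambda>c. (c \<in> spikes, run_length c)) ` {c. run_length c < M} \<subseteq> UNIV \<times> {..<M}" by auto
    ultimately show ?thesis
      by (meson finite_SigmaI finite_class.finite_UNIV finite_lessThan inj_on_finite)
  qed
  then have "finite ((\<lambda>c. \<bar>c\<bar>) ` {c. run_length c < M})" by simp
  then obtain B where B: "\<And>x. x \<in> (\<lambda>c. \<bar>c\<bar>) ` {c. run_length c < M} \<Longrightarrow> x \<le> B"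
    by (meson bdd_above_def bdd_above_finite)
  have "run_length c \<ge> M" if "\<bar>c\<bar> \<ge> B + 1" for c
    using B[of "\<bar>c\<bar>"] that by force
  then show ?thesis by blast
qed

text \<open>
  The integer \<open>c\<close> is written as the block consisting of the bit \<open>c \<in> spikes\<close>, followed by
  \<open>run_length c\<close> ones and a zero, and a sequence is coded by the concatenation of its blocks.
  If one coordinate tends to infinity outside \<open>spikes\<close>, while the earlier ones are kept, then the
  codes converge to a point that is eventually one, whatever the later coordinates are.  The same
  happens inside \<open>spikes\<close>, but with a different limit; this difference is what makes the translations
  discontinuous at these limits.
\<close>

definition block_start :: "(nat \<Rightarrow> int) \<Rightarrow> nat \<Rightarrow> nat" where
  "block_start z n = (\<Sum>i<n. run_length (z i) + 2)"

definition code :: "(nat \<Rightarrow> int) \<Rightarrow> nat \<Rightarrow> bool" where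
  "code z k \<longleftrightarrow>
    \<not> (\<exists>n. (k = block_start z n \<and> z n \<notin> spikes) \<or> Suc k = block_start z (Suc n))"

lemma block_start_Suc: "block_start z (Suc n) = block_start z n + run_length (z n) + 2"
  by (simp add: block_start_def)

lemma block_start_mono: "n \<le> m \<Longrightarrow> block_start z n \<le> block_start z m"
  by (rule lift_Suc_mono_le) (auto simp: block_start_Suc)

lemma block_start_ge: "n \<le> block_start z n"
  by (induction n) (auto simp: block_start_Suc)

lemma block_start_agree: "agree n z z' \<Longrightarrow> m \<le> n \<Longrightarrow> block_start z m = block_start z' m"
  unfolding block_start_def agree_def by (intro sum.cong) auto

lemma block_exists: "\<exists>n. block_start z n \<le> k \<and> k < block_start z (Suc n)"
proof (induction k)
  case 0
  show ?case by (intro exI[of _ 0]) (simp add: block_start_def)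
next
  case (Suc k)
  then obtain n where n: "block_start z n \<le> k" "k < block_start z (Suc n)" by blast
  show ?case
  proof (cases "Suc k < block_start z (Suc n)")
    case True
    then show ?thesis using n by (intro exI[of _ n]) auto
  next
    case False
    then show ?thesis using n by (intro exI[of _ "Suc n"]) (auto simp: block_start_Suc)
  qed
qed

lemma block_unique:
  assumes "block_start z n \<le> k" "k < block_start z (Suc n)"
    and "block_start z m \<le> k" "k < block_start z (Suc m)"
  shows "n = m"
proof (rule ccontr)
  assume "n \<noteq> m"
  then consider "Suc n \<le> m" | "Suc m \<le> n" by linarith
  then show False
  proof cases
    case 1
    then show False using assms block_start_mono[OF 1, of z] by linarith
  next
    case 2
    then show False using assms block_start_mono[OF 2, of z] by linarith
  qed
qed

lemma code_block:
  assumes "block_start z n \<le> k" "k < block_start z (Suc n)"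
  shows "code z k \<longleftrightarrow> (if k = block_start z n then z n \<in> spikes else Suc k \<noteq> block_start z (Suc n))"
proof -
  have 1: "m = n" if "k = block_start z m" for m
    using block_unique[OF assms, of m] block_start_Suc[of z m] that by simp
  have 2: "m = n" if "Suc k = block_start z (Suc m)" for m
    using block_unique[OF assms, of m] block_start_Suc[of z m] that by simp
  have "code z k \<longleftrightarrow> \<not> (k = block_start z n \<and> z n \<notin> spikes) \<and> Suc k \<noteq> block_start z (Suc n)"
    unfolding code_def using 1 2 by blast
  moreover have "Suc k = block_start z (Suc n) \<Longrightarrow> k \<noteq> block_start z n"
    by (simp add: block_start_Suc)
  ultimately show ?thesis by auto
qed

lemma code_header: "code z (block_start z n) \<longleftrightarrow> z n \<in> spikes"
  using code_block[of z n "block_start z n"] by (simp add: block_start_Suc)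

lemma code_agree_blocks:
  assumes "agree n z z'"
  shows "agree (block_start z n) (code z) (code z')"
  unfolding agree_def
proof (intro allI impI)
  fix k assume k: "k < block_start z n"
  obtain m where m: "block_start z m \<le> k" "k < block_start z (Suc m)" using block_exists by blast
  then have "m < n" using k block_start_mono[of n m z] by (cases "m < n") auto
  have "block_start z' m = block_start z m" "block_start z' (Suc m) = block_start z (Suc m)"
    by (rule block_start_agree[OF assms, symmetric], use \<open>m < n\<close> in simp)+
  moreover have "z' m = z m" using assms \<open>m < n\<close> by (simp add: agree_def)
  ultimately have eq: "block_start z' m = block_start z m"
    "block_start z' (Suc m) = block_start z (Suc m)" "z' m = z m" by auto
  show "code z k = code z' k"
    unfolding code_block[OF m] code_block[OF m[folded eq]] eq ..
qed

lemma code_agree: "agree n z z' \<Longrightarrow> agree n (code z) (code z')"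
  by (rule agree_mono[OF code_agree_blocks block_start_ge])

text \<open>
  The blocks form a prefix code, so that they can be read off one after the other; this makes
  \<open>code\<close> a homeomorphism onto its range.
\<close>

lemma code_agreeD:
  assumes "agree (block_start z n) (code z) (code z')"
  shows "agree n z z'"
  using assms
proof (induction n)
  case 0
  show ?case by (simp add: agree_def)
next
  case (Suc n)
  let ?L = "block_start z n"
  have z: "agree n z z'"
    by (rule Suc.IH, rule agree_mono[OF Suc.prems], rule block_start_mono) simp
  then have L: "block_start z' n = ?L" by (rule block_start_agree[symmetric]) simp
  have c: "code z k = code z' k" if "k < block_start z (Suc n)" for k
    using Suc.prems that by (simp add: agree_def)
  have header: "z n \<in> spikes \<longleftrightarrow> z' n \<in> spikes"
    using code_header[of z n] code_header[of z' n] c[of ?L] L by (simp add: block_start_Suc)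
  have "\<not> run_length (z n) < run_length (z' n)"
  proof
    assume less: "run_length (z n) < run_length (z' n)"
    have "\<not> code z (?L + 1 + run_length (z n))"
      by (subst code_block[of z n]) (auto simp: block_start_Suc)
    moreover have "code z' (?L + 1 + run_length (z n))"
      using less L by (subst code_block[of z' n]) (auto simp: block_start_Suc)
    ultimately show False using c[of "?L + 1 + run_length (z n)"] by (simp add: block_start_Suc)
  qed
  moreover have "\<not> run_length (z' n) < run_length (z n)"
  proof
    assume less: "run_length (z' n) < run_length (z n)"
    have "\<not> code z' (?L + 1 + run_length (z' n))"
      using L by (subst code_block[of z' n]) (auto simp: block_start_Suc)
    moreover have "code z (?L + 1 + run_length (z' n))"
      using less by (subst code_block[of z n]) (auto simp: block_start_Suc)
    ultimately show False using c[of "?L + 1 + run_length (z' n)"] less by (simp add: block_start_Suc)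
  qed
  ultimately have "z n = z' n" using header by (intro run_length_inj) auto
  then show ?case using z by (auto simp: agree_def less_Suc_eq)
qed

lemma inj_code: "inj code"
  by (rule injI) (metis agree_refl code_agreeD not_agree_ex)

text \<open>
  A given point is approximated block by block.  Its own blocks are copied as long as they are
  complete; a run of ones that continues beyond the desired precision \<open>M\<close> is cut off there.
\<close>

lemma code_dense: "\<exists>z. agree M x (code z)"
proof -
  have "\<exists>z. agree (min M (block_start z n)) x (code z)" for n
  proof (induction n)
    case 0
    show ?case by (simp add: block_start_def agree_def)
  next
    case (Suc n)
    then obtain z where z: "agree (min M (block_start z n)) x (code z)" by blast
    let ?L = "block_start z n"
    \<comment> \<open>the length of the run of ones that the next block of \<open>x\<close> contains\<close>
    define i where "i = (LEAST i. i \<ge> M \<or> \<not> x (?L + 1 + i))"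
    have i: "i \<ge> M \<or> \<not> x (?L + 1 + i)"
      unfolding i_def by (rule LeastI[of _ M]) simp
    have i': "x (?L + 1 + j)" if "j < i" for j
      using not_less_Least[OF that[unfolded i_def]] by simp
    obtain c where c: "c \<in> spikes \<longleftrightarrow> x ?L" "run_length c = i" using run_length_surj by blast
    define z' where "z' = z(n := c)"
    have zz: "agree n z z'" by (simp add: z'_def agree_def)
    then have L: "block_start z' n = ?L" by (rule block_start_agree[symmetric]) simp
    have L': "block_start z' (Suc n) = ?L + i + 2"
      using c by (simp add: block_start_Suc L) (simp add: z'_def)
    have "x k = code z' k" if k: "k < M" "k < ?L + i + 2" for k
    proof (cases "k < ?L")
      case True
      then show ?thesis
        using z k code_agree_blocks[OF zz] by (simp add: agree_def)
    next
      case False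
      then have "code z' k \<longleftrightarrow> (if k = ?L then z' n \<in> spikes else Suc k \<noteq> ?L + i + 2)"
        using code_block[of z' n k] k L L' by simp
      also have "\<dots> \<longleftrightarrow> x k"
      proof (cases "k = ?L")
        case True
        then show ?thesis using c by (simp add: z'_def)
      next
        case 2: False
        define j where "j = k - ?L - 1"
        have j: "k = ?L + 1 + j" "j \<le> i" using False 2 k by (auto simp: j_def)
        show ?thesis using i i'[of j] j k by (cases "j = i") auto
      qed
      finally show ?thesis by simp
    qed
    then show ?case using L' by (intro exI[of _ z']) (simp add: agree_def)
  qed
  then obtain z where "agree (min M (block_start z M)) x (code z)" by blast
  then show ?thesis using block_start_ge[of M z] by (auto simp: min_absorb1)
qed

text \<open>
  These are the limits just described: the blocks of such a sequence can be read off until one of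
  them fails to terminate.
\<close>

definition ends :: "(nat \<Rightarrow> bool) set" where
  "ends = {x. \<exists>n. \<forall>k\<ge>n. x k}"

lemma ends_dense: "\<exists>p\<in>ends. agree M x p"
  by (intro bexI[of _ "\<lambda>k. k \<ge> M \<or> x k"]) (auto simp: agree_def ends_def)

lemma countable_ends: "countable ends"
proof -
  have "countable {x :: nat \<Rightarrow> bool. \<forall>k\<ge>n. x k}" for n
  proof -
    have "inj_on (\<lambda>x. map x [0..<n]) {x :: nat \<Rightarrow> bool. \<forall>k\<ge>n. x k}"
    proof (rule inj_onI)
      fix x y :: "nat \<Rightarrow> bool"
      assume "x \<in> {x. \<forall>k\<ge>n. x k}" "y \<in> {x. \<forall>k\<ge>n. x k}" "map x [0..<n] = map y [0..<n]"
      then have "x k = y k" for k by (cases "k < n") auto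
      then show "x = y" by (rule ext)
    qed
    then show ?thesis by (rule countable_image_inj_on[OF countableI_type])
  qed
  then have "countable (\<Union>n. {x :: nat \<Rightarrow> bool. \<forall>k\<ge>n. x k})" by simp
  also have "(\<Union>n. {x. \<forall>k\<ge>n. x k}) = ends" by (auto simp: ends_def)
  finally show ?thesis .
qed

lemma code_not_ends: "code z \<notin> ends"
proof
  assume "code z \<in> ends"
  then obtain n where n: "\<forall>k\<ge>n. code z k" by (auto simp: ends_def)
  let ?k = "block_start z n + run_length (z n) + 1"
  have "\<not> code z ?k" by (subst code_block[of z n]) (auto simp: block_start_Suc)
  moreover have "?k \<ge> n" using block_start_ge[of n z] by simp
  ultimately show False using n by blast
qed

lemma code_tendsto_end:
  "\<exists>p\<in>ends. \<forall>M. \<exists>B. \<forall>z'. agree n z z' \<and> z' n \<notin> spikes \<and> \<bar>z' n\<bar> \<ge> B \<longrightarrow> agree M p (code z')"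
proof (intro bexI allI)
  let ?L = "block_start z n"
  define p where "p k = (if k < ?L then code z k else k \<noteq> ?L)" for k
  show "p \<in> ends"
    unfolding ends_def by (auto simp: p_def intro!: exI[of _ "Suc ?L"])
  fix M
  obtain B where B: "\<And>c. \<bar>c\<bar> \<ge> B \<Longrightarrow> run_length c \<ge> M" using run_length_tendsto by blast
  have "agree M p (code z')" if z': "agree n z z'" "z' n \<notin> spikes" "\<bar>z' n\<bar> \<ge> B" for z'
    unfolding agree_def
  proof (intro allI impI)
    fix k assume k: "k < M"
    have L: "block_start z' n = ?L" using block_start_agree[OF z'(1) order_refl] by simp
    have r: "run_length (z' n) \<ge> M" using B z' by blast
    show "p k = code z' k"
    proof (cases "k < ?L")
      case True
      then show ?thesis using code_agree_blocks[OF z'(1)] by (simp add: p_def agree_def)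
    next
      case False
      then show ?thesis
        using code_block[of z' n k] r k L z' by (simp add: p_def block_start_Suc)
    qed
  qed
  then show "\<exists>B. \<forall>z'. agree n z z' \<and> z' n \<notin> spikes \<and> \<bar>z' n\<bar> \<ge> B \<longrightarrow> agree M p (code z')" by blast
qed

section \<open>Martin's Axiom bounds small families of functions\<close>

lemma nat_lesspoll_nat_bool: "(UNIV :: nat set) \<prec> (UNIV :: (nat \<Rightarrow> bool) set)"
proof -
  have "Pow (UNIV :: nat set) \<lesssim> (UNIV :: (nat \<Rightarrow> bool) set)"
    unfolding lepoll_def by (rule exI[of _ "\<lambda>A n. n \<in> A"]) (auto simp: inj_on_def fun_eq_iff)
  then show ?thesis by (rule lesspoll_trans2[OF lesspoll_Pow_self])
qed

lemma countable_lesspoll_nat_bool: "countable A \<Longrightarrow> A \<prec> (UNIV :: (nat \<Rightarrow> bool) set)"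
  by (meson countable_def lepoll_def lesspoll_trans1 nat_lesspoll_nat_bool subset_UNIV)

text \<open>
  For the bookkeeping of countably many functions for each of fewer than continuum many objects.
\<close>

lemma Times_nat_lesspoll:
  assumes A: "A \<prec> (UNIV :: (nat \<Rightarrow> bool) set)"
  shows "A \<times> (UNIV :: nat set) \<prec> (UNIV :: (nat \<Rightarrow> bool) set)"
proof (cases "finite A")
  case True
  then have "countable (A \<times> (UNIV :: nat set))" by (simp add: countable_finite)
  then show ?thesis by (rule countable_lesspoll_nat_bool)
next
  case False
  have "A \<times> (UNIV :: nat set) \<lesssim> A \<times> A"
    using False by (intro times_lepoll_mono) (auto simp: infinite_le_lepoll)
  moreover have "A \<times> A \<approx> A"
    using card_of_Times_same_infinite[OF False] unfolding eqpoll_def card_of_ordIso .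
  ultimately show ?thesis
    using A by (meson eqpoll_imp_lepoll lepoll_trans lesspoll_trans1)
qed

text \<open>
  Hechler forcing.  A condition \<open>(s, G)\<close> consists of a finite initial segment \<open>s\<close> of the
  bounding function and a finite set \<open>G\<close> of functions that all further values have to dominate.
  Conditions with the same \<open>s\<close> are compatible by uniting their second components, and there are
  only countably many \<open>s\<close>.
\<close>

theorem MA_imp_eventually_bounded:
  fixes F :: "(nat \<Rightarrow> nat) set"
  assumes MA: "MA_sigma_centered" and F: "F \<prec> (UNIV :: (nat \<Rightarrow> bool) set)"
  shows "\<exists>h. \<forall>f\<in>F. \<forall>\<^sub>F i in sequentially. f i \<le> h i"
proof -
  define P where "P = {(s :: nat list, G). finite G \<and> G \<subseteq> F}"
  define le where "le = (\<lambda>(s' :: nat list, G') (s, G). (G :: (nat \<Rightarrow> nat) set) \<subseteq> G' \<and>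
    length s \<le> length s' \<and> (\<forall>i<length s. s' ! i = s ! i) \<and>
    (\<forall>i. length s \<le> i \<and> i < length s' \<longrightarrow> (\<forall>f\<in>G. f i \<le> s' ! i)))"
  define r where "r = {(q, p). q \<in> P \<and> p \<in> P \<and> le q p}"
  define D where "D = (\<lambda>(f, n). {(s, G). (s, G) \<in> P \<and> f \<in> G \<and> n \<le> length s})"
  have "\<exists>\<G>. poset_filter P r \<G> \<and> (\<forall>E\<in>D ` (F \<times> UNIV). \<G> \<inter> E \<noteq> {})"
  proof (rule MA_sigma_centered_preorder[OF MA])
    show "P \<noteq> {}" by (auto simp: P_def)
    have tr: "le a c" if "le a b" "le b c" for a b c
    proof -
      obtain s G t H u I where abc: "a = (s, G)" "b = (t, H)" "c = (u, I)"
        by (cases a, cases b, cases c)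
      have "f i \<le> s ! i" if "length u \<le> i" "i < length s" "f \<in> I" for f i
        using that \<open>le a b\<close> \<open>le b c\<close> by (cases "i < length t") (auto simp: abc le_def)
      then show ?thesis using that by (auto simp: abc le_def)
    qed
    have "le p p" for p
      by (cases p) (auto simp: le_def)
    then show "preorder_on P r"
      unfolding preorder_on_def refl_on_def trans_def r_def using tr by blast
    show "sigma_centered P r"
      unfolding sigma_centered_def centered_def
    proof (intro exI[of _ "\<lambda>n. {(s, G). (s, G) \<in> P \<and> to_nat s = n}"] conjI allI impI)
      fix n F'
      assume F': "finite F' \<and> F' \<subseteq> {(s, G). (s, G) \<in> P \<and> to_nat s = n}"
      let ?q = "(from_nat n, \<Union> (snd ` F'))"
      have "?q \<in> P" using F' by (force simp: P_def)
      moreover have "(?q, p) \<in> r" if "p \<in> F'" for p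
        using F' that \<open>?q \<in> P\<close> by (cases p) (force simp: r_def le_def)
      ultimately show "\<exists>q\<in>P. \<forall>p\<in>F'. (q, p) \<in> r" by blast
    qed (auto simp: P_def)
    show "D ` (F \<times> UNIV) \<prec> (UNIV :: (nat \<Rightarrow> bool) set)"
      by (rule lesspoll_trans1[OF image_lepoll Times_nat_lesspoll[OF F]])
  next
    fix E assume "E \<in> D ` (F \<times> UNIV)"
    then obtain f n where f: "f \<in> F" and E: "E = D (f, n)" by auto
    show "poset_dense P r E"
      unfolding poset_dense_def
    proof (intro conjI ballI)
      show "E \<subseteq> P" by (auto simp: E D_def)
      fix p assume p: "p \<in> P"
      obtain s G where sG: "p = (s, G)" by (cases p)
      have G: "finite G" "G \<subseteq> F" using p by (auto simp: P_def sG)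
      define s' where "s' = s @ map (\<lambda>i. \<Sum>f\<in>G. f i) [length s..<length s + n]"
      have "g i \<le> s' ! i" if "length s \<le> i" "i < length s'" "g \<in> G" for g i
        using that G member_le_sum[of g G "\<lambda>f. f i"] by (simp add: s'_def nth_append)
      then have "le (s', insert f G) p"
        by (auto simp: le_def sG s'_def nth_append)
      moreover have "(s', insert f G) \<in> P" using G f by (simp add: P_def)
      moreover have "(s', insert f G) \<in> E"
        using calculation by (simp add: E D_def s'_def)
      ultimately show "\<exists>d\<in>E. (d, p) \<in> r" using p by (auto simp: r_def)
    qed
  qed
  then obtain \<G> where filt: "poset_filter P r \<G>" and meet: "\<And>f n. f \<in> F \<Longrightarrow> \<G> \<inter> D (f, n) \<noteq> {}"
    by auto
  define p where "p i = (SOME q. q \<in> \<G> \<and> i < length (fst q))" for i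
  define h where "h i = fst (p i) ! i" for i
  have "\<forall>\<^sub>F i in sequentially. f i \<le> h i" if f: "f \<in> F" for f
  proof -
    obtain s G where sG: "(s, G) \<in> \<G>" "f \<in> G"
      using meet[OF f, of 0] by (auto simp: D_def)
    have "f i \<le> h i" if i: "length s \<le> i" for i
    proof -
      have "\<exists>q. q \<in> \<G> \<and> i < length (fst q)"
        using meet[OF f, of "Suc i"] by (force simp: D_def)
      then have pi: "p i \<in> \<G>" "i < length (fst (p i))"
        unfolding p_def by (metis (mono_tags, lifting) someI_ex)+
      obtain q where q: "(q, (s, G)) \<in> r" "(q, p i) \<in> r"
        using filt sG(1) pi(1) unfolding poset_filter_def by meson
      obtain t H where t: "q = (t, H)" by (cases q)
      obtain u I where u: "p i = (u, I)" by (cases "p i")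
      have "i < length t" "t ! i = u ! i"
        using q(2) pi(2) by (auto simp: r_def le_def t u)
      moreover have "f i \<le> t ! i"
        using q(1) sG(2) i calculation by (auto simp: r_def le_def t)
      ultimately show ?thesis by (simp add: h_def u)
    qed
    then show ?thesis unfolding eventually_sequentially by blast
  qed
  then show ?thesis by blast
qed

section \<open>Homeomorphisms by strictly causal displacements\<close>

text \<open>
  If \<open>\<delta>\<close> is strictly causal, then the \<open>m\<close>-th coordinate of \<open>x + \<delta> x\<close> differs from that of
  \<open>x\<close> by an amount that depends only on the earlier coordinates of \<open>x\<close>.  So \<open>x\<close> can be
  recovered coordinate by coordinate, and \<open>x \<mapsto> x + \<delta> x\<close> is a bijection of
  \<open>\<int>\<^sup>\<omega>\<close> that preserves the length of common initial segments in both directions.  Continuity and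
  bijectivity thus come for free, also for limits of such maps.
\<close>

definition strictly_causal :: "((nat \<Rightarrow> int) \<Rightarrow> nat \<Rightarrow> int) \<Rightarrow> bool" where
  "strictly_causal \<delta> \<longleftrightarrow> (\<forall>x y m. agree m x y \<longrightarrow> agree (Suc m) (\<delta> x) (\<delta> y))"

lemma strictly_causalD: "strictly_causal \<delta> \<Longrightarrow> agree m x y \<Longrightarrow> agree (Suc m) (\<delta> x) (\<delta> y)"
  by (simp add: strictly_causal_def)

lemma agree_Suc: "agree (Suc m) x y \<longleftrightarrow> agree m x y \<and> x m = y m"
  by (auto simp: agree_def less_Suc_eq)

lemma displacement_agree_iff:
  assumes "strictly_causal \<delta>"
  shows "agree m (x + \<delta> x) (y + \<delta> y) \<longleftrightarrow> agree m x y"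
proof (induction m)
  case 0
  show ?case by (simp add: agree_def)
next
  case (Suc m)
  have "x m + \<delta> x m = y m + \<delta> y m \<longleftrightarrow> x m = y m" if "agree m x y"
    using strictly_causalD[OF assms that] by (simp add: agree_Suc)
  then show ?case using Suc.IH by (auto simp: agree_Suc)
qed

lemma displacement_inj:
  assumes "strictly_causal \<delta>" "x + \<delta> x = y + \<delta> y"
  shows "x = y"
proof (rule ccontr)
  assume "x \<noteq> y"
  then obtain m where "\<not> agree m x y" using not_agree_ex by blast
  then show False using displacement_agree_iff[OF assms(1), of m x y] assms(2) by simp
qed

lemma displacement_surj:
  assumes "strictly_causal \<delta>"
  shows "\<exists>x. x + \<delta> x = y"
proof -
  have "\<exists>x. \<forall>m. x m = y m - \<delta> (\<lambda>i. if i < m then x i else 0) m"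
  proof (rule dependent_wf_choice[where R = less_than and
        P = "\<lambda>x m r. r = y m - \<delta> (\<lambda>i. if i < m then x i else 0) m"])
    fix f g :: "nat \<Rightarrow> int" and m r
    assume "\<And>i. (i, m) \<in> less_than \<Longrightarrow> f i = g i"
    then have "(\<lambda>i. if i < m then f i else 0) = (\<lambda>i. if i < m then g i else 0)" by auto
    then show "(r = y m - \<delta> (\<lambda>i. if i < m then f i else 0) m) =
        (r = y m - \<delta> (\<lambda>i. if i < m then g i else 0) m)" by (simp only:)
  qed auto
  then obtain x where x: "\<And>m. x m = y m - \<delta> (\<lambda>i. if i < m then x i else 0) m" by blast
  have "(x + \<delta> x) m = y m" for m
  proof -
    have "agree m x (\<lambda>i. if i < m then x i else 0)" by (simp add: agree_def)
    then have "\<delta> x m = \<delta> (\<lambda>i. if i < m then x i else 0) m"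
      using strictly_causalD[OF assms] by (metis agree_Suc)
    then show ?thesis using x[of m] by simp
  qed
  then show ?thesis by (intro exI[of _ x] ext)
qed

definition seq_closed :: "(nat \<Rightarrow> 'a) set \<Rightarrow> bool" where
  "seq_closed K \<longleftrightarrow> (\<forall>x. x \<notin> K \<longrightarrow> (\<exists>m. \<forall>y. agree m x y \<longrightarrow> y \<notin> K))"

lemma finite_avoid:
  assumes "finite F" "x \<notin> F"
  shows "\<exists>m. \<forall>y\<in>F. \<not> agree m x y"
  using assms
proof (induction F)
  case (insert z F)
  then obtain m where m: "\<forall>y\<in>F. \<not> agree m x y" by blast
  obtain k where k: "\<not> agree k x z" using insert.prems not_agree_ex[of x z] by blast
  have "\<forall>y\<in>insert z F. \<not> agree (max m k) x y"
    using m k agree_mono[of "max m k" x _ m] agree_mono[of "max m k" x z k] by auto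
  then show ?case by blast
qed simp

text \<open>
  Unspecified if \<open>a = x\<close>.
\<close>

definition first_diff :: "(nat \<Rightarrow> 'a) \<Rightarrow> (nat \<Rightarrow> 'a) \<Rightarrow> nat" where
  "first_diff a x = (LEAST i. a i \<noteq> x i)"

lemma agree_iff_first_diff: "a \<noteq> x \<Longrightarrow> agree m a x \<longleftrightarrow> m \<le> first_diff a x"
proof -
  assume "a \<noteq> x"
  then obtain i where "a i \<noteq> x i" by (auto simp: fun_eq_iff)
  then have ne: "a (first_diff a x) \<noteq> x (first_diff a x)"
    unfolding first_diff_def by (rule LeastI)
  have eq: "a i = x i" if "i < first_diff a x" for i
    using not_less_Least[OF that[unfolded first_diff_def]] by simp
  show ?thesis
  proof
    show "m \<le> first_diff a x" if "agree m a x"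
      using that ne unfolding agree_def by (meson not_le)
    show "agree m a x" if "m \<le> first_diff a x"
      using that eq unfolding agree_def by simp
  qed
qed

lemma first_diff_cong:
  assumes "agree k x y" "\<not> agree k a x"
  shows "first_diff a x = first_diff a y"
proof -
  have ne: "a \<noteq> x" "a \<noteq> y" using assms agree_refl agree_sym by blast+
  have "agree j a x \<longleftrightarrow> agree j a y" if "j \<le> k" for j
    using agree_mono[OF assms(1) that] agree_trans agree_sym by metis
  moreover have "\<not> agree k a y"
    using calculation assms by blast
  ultimately show ?thesis
    using agree_iff_first_diff[OF ne(1)] agree_iff_first_diff[OF ne(2)] assms(2)
    by (metis eq_iff nat_le_linear)
qed

text \<open>
  Two countable dense subsets \<open>A\<close> and \<open>B\<close> of \<open>E\<close> are to be matched.  Their complements in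
  \<open>E\<close> are dense as well, since points of \<open>E - A\<close> have to be matched with points of \<open>E - B\<close>.
\<close>

locale back_and_forth =
  fixes A B E :: "(nat \<Rightarrow> int) set"
  assumes shift_E: "\<And>x u. x \<in> E \<Longrightarrow> u \<in> shifts \<Longrightarrow> x + u \<in> E"
    and A_subset: "A \<subseteq> E" and B_subset: "B \<subseteq> E"
    and A_dense: "\<And>x m. x \<in> E \<Longrightarrow> \<exists>a\<in>A. agree m x a"
    and coA_dense: "\<And>x m. x \<in> E \<Longrightarrow> \<exists>a\<in>E - A. agree m x a"
    and B_dense: "\<And>x m. x \<in> E \<Longrightarrow> \<exists>b\<in>B. agree m x b"
    and coB_dense: "\<And>x m. x \<in> E \<Longrightarrow> \<exists>b\<in>E - B. agree m x b"
begin

text \<open>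
  In an approximation, finitely many points of \<open>E\<close> have received their final values; off these
  points, the map is locally a translation by an element of \<open>shifts\<close>.
\<close>

definition admissible :: "((nat \<Rightarrow> int) \<Rightarrow> nat \<Rightarrow> int) \<Rightarrow> (nat \<Rightarrow> int) set \<Rightarrow> bool" where
  "admissible \<delta> F \<longleftrightarrow> strictly_causal \<delta> \<and> finite F \<and> F \<subseteq> E \<and>
    (\<forall>x. x \<notin> F \<longrightarrow> (\<exists>u\<in>shifts. \<exists>m. \<forall>y. agree m x y \<longrightarrow> \<delta> y = u)) \<and>
    (\<forall>x\<in>F. x + \<delta> x \<in> E \<and> (x \<in> A \<longleftrightarrow> x + \<delta> x \<in> B))"

text \<open>
  On a ball around \<open>a\<close> that is translated by \<open>u\<close>, the map can be changed so that \<open>a\<close> goes to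
  any \<open>b\<close> in the image of the ball.  The ball without \<open>a\<close> is the disjoint union of the shells of
  points whose first difference from \<open>a\<close> is at \<open>j\<close>.  The new map translates the \<open>j\<close>-th
  shell by some \<open>\<rho> j\<close> in \<open>shifts\<close> that agrees with \<open>b - a\<close> up to and including
  \<open>j\<close>.  The displacements converge to \<open>b - a\<close> as the shells shrink to \<open>a\<close>, fast enough for
  strict causality.
\<close>

lemma redirect_on_ball:
  assumes adm: "admissible \<delta> F"
    and ab: "a \<in> E" "b \<in> E" "a \<in> A \<longleftrightarrow> b \<in> B"
    and F: "\<And>x. x \<in> F \<Longrightarrow> \<not> agree m a x"
    and const: "\<And>x. agree m a x \<Longrightarrow> \<delta> x = u"
    and close: "agree m (a + u) b"
  shows "\<exists>\<delta>'. admissible \<delta>' (insert a F) \<and> a + \<delta>' a = b \<and>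
    (\<forall>x. \<not> agree m a x \<longrightarrow> \<delta>' x = \<delta> x) \<and> (\<forall>x. agree m (\<delta> x) (\<delta>' x))"
proof -
  have "\<forall>j. \<exists>u. u \<in> shifts \<and> agree (Suc j) (b - a) u" using shifts_dense by blast
  then obtain \<rho> where \<rho>: "\<And>j. \<rho> j \<in> shifts" "\<And>j. agree (Suc j) (b - a) (\<rho> j)"
    by (auto dest!: choice)
  define \<delta>' where
    "\<delta>' x = (if x = a then b - a else if agree m a x then \<rho> (first_diff a x) else \<delta> x)" for x
  have causal: "strictly_causal \<delta>" using adm by (simp add: admissible_def)
  have u: "agree m (b - a) u" using close by (simp add: agree_def algebra_simps)
  have out: "\<delta>' x = \<delta> x" if "\<not> agree m a x" for x
    using that by (auto simp: \<delta>'_def)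
  have close': "agree (Suc k) (b - a) (\<delta>' x)" if "agree m a x" "agree k a x" for x k
  proof (cases "x = a")
    case True
    then show ?thesis by (simp add: \<delta>'_def)
  next
    case False
    then have "k \<le> first_diff a x" using that agree_iff_first_diff[of a x k] by auto
    then have "agree (Suc k) (b - a) (\<rho> (first_diff a x))"
      by (intro agree_mono[OF \<rho>(2)]) simp
    then show ?thesis using False that by (simp add: \<delta>'_def)
  qed
  have mixed: "agree (Suc k) (\<delta>' x) (\<delta>' y)"
    if "agree k x y" "agree m a x" "\<not> agree m a y" for k x y
  proof -
    have "\<not> m \<le> k"
    proof
      assume "m \<le> k"
      then have "agree m x y" by (rule agree_mono[OF that(1)])
      then show False using that agree_trans by blast
    qed
    then have k: "Suc k \<le> m" by simp
    then have kx: "agree k a x" using that agree_mono[of m a x k] by simp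
    then have "agree k a y" using that agree_trans by blast
    then have "agree (Suc k) (\<delta> a) (\<delta> y)" by (rule strictly_causalD[OF causal])
    moreover have "\<delta> a = u" by (rule const) simp
    moreover have "agree (Suc k) (b - a) u" using u k by (rule agree_mono)
    moreover have "agree (Suc k) (b - a) (\<delta>' x)" using close' that kx by blast
    ultimately show ?thesis using out[OF that(3)] agree_trans agree_sym by metis
  qed
  have "strictly_causal \<delta>'"
    unfolding strictly_causal_def
  proof (intro allI impI)
    fix x y :: "nat \<Rightarrow> int" and k
    assume xy: "agree k x y"
    consider "agree m a x" "agree m a y" | "agree m a x" "\<not> agree m a y"
      | "\<not> agree m a x" "agree m a y" | "\<not> agree m a x" "\<not> agree m a y" by blast
    then show "agree (Suc k) (\<delta>' x) (\<delta>' y)"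
    proof cases
      case 1
      show ?thesis
      proof (cases "agree k a x")
        case True
        then have "agree k a y" using xy agree_trans by blast
        then show ?thesis using close' 1 True agree_trans agree_sym by metis
      next
        case False
        then have "x \<noteq> a" "y \<noteq> a" using xy agree_sym by auto
        then have "\<delta>' x = \<delta>' y" using first_diff_cong[OF xy False] 1 by (simp add: \<delta>'_def)
        then show ?thesis by simp
      qed
    next
      case 2
      then show ?thesis using mixed xy by blast
    next
      case 3
      then have "agree (Suc k) (\<delta>' y) (\<delta>' x)" using mixed xy agree_sym by metis
      then show ?thesis by (simp add: agree_sym)
    next
      case 4
      then show ?thesis using out strictly_causalD[OF causal xy] by simp
    qed
  qed
  moreover have "\<exists>v\<in>shifts. \<exists>k. \<forall>y. agree k x y \<longrightarrow> \<delta>' y = v" if x: "x \<notin> insert a F" for x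
  proof (cases "agree m a x")
    case True
    let ?j = "first_diff a x"
    have ax: "a \<noteq> x" using x by auto
    have j: "m \<le> ?j" "\<not> agree (Suc ?j) a x"
      using True agree_iff_first_diff[OF ax] by auto
    have "\<delta>' y = \<rho> ?j" if y: "agree (Suc ?j) x y" for y
    proof -
      have "agree m a y"
        using True j(1) agree_mono[OF y, of m] agree_trans[of m a x y] by simp
      moreover have "y \<noteq> a" using y j(2) agree_sym by metis
      moreover have "first_diff a y = ?j" using first_diff_cong[OF y j(2)] by simp
      ultimately show ?thesis by (simp add: \<delta>'_def)
    qed
    then show ?thesis using \<rho>(1) by blast
  next
    case False
    obtain v k where v: "v \<in> shifts" and k: "\<And>y. agree k x y \<Longrightarrow> \<delta> y = v"
      using adm x unfolding admissible_def by blast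
    have "\<delta>' y = v" if y: "agree (max k m) x y" for y
    proof -
      have "\<not> agree m a y"
        using False agree_mono[OF y, of m] agree_trans[of m a y x] agree_sym[of m x y] by auto
      then show ?thesis using out k agree_mono[OF y, of k] by simp
    qed
    then show ?thesis using v by blast
  qed
  moreover have "x + \<delta>' x \<in> E \<and> (x \<in> A \<longleftrightarrow> x + \<delta>' x \<in> B)" if "x \<in> insert a F" for x
  proof (cases "x = a")
    case True
    then show ?thesis using ab by (simp add: \<delta>'_def)
  next
    case False
    then have "x \<in> F" using that by simp
    then show ?thesis using out F adm by (simp add: admissible_def)
  qed
  ultimately have "admissible \<delta>' (insert a F)"
    using adm ab unfolding admissible_def by blast
  moreover have "agree m (\<delta> x) (\<delta>' x)" for x
  proof (cases "agree m a x")
    case True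
    then have "agree m (b - a) (\<delta>' x)" using close' agree_mono by (meson le_SucI order_refl)
    then show ?thesis using u const[OF True] agree_trans agree_sym by metis
  qed (simp add: out)
  ultimately show ?thesis using out by (intro exI[of _ \<delta>']) (simp add: \<delta>'_def)
qed

text \<open>
  A refinement step keeps the map on \<open>K\<close> and its inverse on \<open>K\<close>, whence the two conditions
  \<open>x \<in> K\<close> and \<open>x + fst s x \<in> K\<close>.
\<close>

definition refines :: "nat \<Rightarrow> (nat \<Rightarrow> int) set \<Rightarrow> ((nat \<Rightarrow> int) \<Rightarrow> nat \<Rightarrow> int) \<times> (nat \<Rightarrow> int) set \<Rightarrow>
    ((nat \<Rightarrow> int) \<Rightarrow> nat \<Rightarrow> int) \<times> (nat \<Rightarrow> int) set \<Rightarrow> bool" where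
  "refines n K s s' \<longleftrightarrow> snd s \<subseteq> snd s' \<and> (\<forall>x. agree n (fst s x) (fst s' x)) \<and>
    (\<forall>x. x \<in> snd s \<or> x \<in> K \<or> x + fst s x \<in> K \<longrightarrow> fst s' x = fst s x)"

lemma refines_trans: "refines n K s s' \<Longrightarrow> refines n K s' s'' \<Longrightarrow> refines n K s s''"
proof -
  assume 1: "refines n K s s'" and 2: "refines n K s' s''"
  have eq: "fst s'' x = fst s x" if x: "x \<in> snd s \<or> x \<in> K \<or> x + fst s x \<in> K" for x
  proof -
    have 3: "fst s' x = fst s x" using 1 x unfolding refines_def by blast
    have "x \<in> snd s' \<or> x \<in> K \<or> x + fst s' x \<in> K"
      unfolding 3 using 1 x unfolding refines_def by blast
    then have "fst s'' x = fst s' x" using 2 unfolding refines_def by blast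
    then show ?thesis using 3 by simp
  qed
  have "agree n (fst s x) (fst s'' x)" for x
    by (rule agree_trans[of n _ "fst s' x"]) (use 1 2 in \<open>simp_all add: refines_def\<close>)
  moreover have "snd s \<subseteq> snd s''" using 1 2 unfolding refines_def by blast
  ultimately show ?thesis unfolding refines_def using eq by blast
qed

text \<open>
  The radius is so large that the ball around \<open>x\<close> misses \<open>F\<close>, and that both the ball and its
  image miss \<open>K\<close>.  The latter uses that \<open>x\<close> and its image are in \<open>E\<close>, which is disjoint from
  the closed set \<open>K\<close>.  The first step of a pair of steps changes the image of the centre
  (\<open>a = x\<close>), the second one its preimage (\<open>b = x + \<delta> x\<close>).
\<close>

lemma redirect_near:
  assumes adm: "admissible \<delta> F" and x: "x \<in> E" "x \<notin> F"
    and K: "seq_closed K" "K \<inter> E = {}"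
  shows "x + \<delta> x \<in> E \<and>
    (\<exists>m. \<forall>a\<in>E. \<forall>b\<in>E. agree m x a \<and> agree m (x + \<delta> x) b \<and> (a \<in> A \<longleftrightarrow> b \<in> B) \<longrightarrow>
      (\<exists>\<delta>'. admissible \<delta>' (insert a F) \<and> a + \<delta>' a = b \<and> refines n K (\<delta>, F) (\<delta>', insert a F)))"
proof -
  obtain u m0 where u: "u \<in> shifts" and m0: "\<And>y. agree m0 x y \<Longrightarrow> \<delta> y = u"
    using adm x(2) unfolding admissible_def by blast
  have \<delta>x: "\<delta> x = u" by (rule m0) simp
  have xu: "x + u \<in> E" using shift_E x u by blast
  obtain m1 where m1: "\<And>y. y \<in> F \<Longrightarrow> \<not> agree m1 x y"
    using finite_avoid[of F x] adm x unfolding admissible_def by blast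
  obtain m2 where m2: "\<And>y. agree m2 x y \<Longrightarrow> y \<notin> K"
    using K x unfolding seq_closed_def by (meson disjoint_iff)
  obtain m3 where m3: "\<And>y. agree m3 (x + u) y \<Longrightarrow> y \<notin> K"
    using K xu unfolding seq_closed_def by (meson disjoint_iff)
  define m where "m = n + m0 + m1 + m2 + m3"
  have "\<exists>\<delta>'. admissible \<delta>' (insert a F) \<and> a + \<delta>' a = b \<and> refines n K (\<delta>, F) (\<delta>', insert a F)"
    if ab: "a \<in> E" "b \<in> E" "agree m x a" "agree m (x + \<delta> x) b" "a \<in> A \<longleftrightarrow> b \<in> B" for a b
  proof -
    have ball: "agree m a y \<longleftrightarrow> agree m x y" for y
      using ab(3) agree_trans agree_sym by metis
    have F: "\<not> agree m a y" if "y \<in> F" for y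
      using m1[OF that] agree_mono[of m x y m1] unfolding ball by (auto simp: m_def)
    have const: "\<delta> y = u" if "agree m a y" for y
      by (rule m0, rule agree_mono[OF that[unfolded ball]]) (simp add: m_def)
    have "agree m (a + u) (x + u)"
      using ab(3) by (intro agree_add) (simp_all add: agree_sym)
    then have "agree m (a + u) b" using ab(4) \<delta>x agree_trans by metis
    then obtain \<delta>' where \<delta>': "admissible \<delta>' (insert a F)" "a + \<delta>' a = b"
      "\<And>y. \<not> agree m a y \<Longrightarrow> \<delta>' y = \<delta> y" "\<And>y. agree m (\<delta> y) (\<delta>' y)"
      using redirect_on_ball[OF adm ab(1,2,5) F const] by blast
    have "\<not> agree m a y" if y: "y \<in> F \<or> y \<in> K \<or> y + \<delta> y \<in> K" for y
    proof
      assume y': "agree m a y"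
      then have "agree m x y" by (simp add: ball)
      then have "agree m2 x y" "agree m3 (x + u) (y + u)"
        using agree_mono[of m x y] by (auto simp: m_def intro: agree_add)
      then show False using y y' m2 m3 F const by metis
    qed
    then have "refines n K (\<delta>, F) (\<delta>', insert a F)"
      unfolding refines_def using \<delta>'(3) agree_mono[OF \<delta>'(4), of n] by (auto simp: m_def)
    then show ?thesis using \<delta>' by blast
  qed
  then show ?thesis using xu \<delta>x by (intro conjI exI[of _ m]) auto
qed

lemma extend_domain:
  assumes adm: "admissible \<delta> F" and e: "e \<in> E" and K: "seq_closed K" "K \<inter> E = {}"
  shows "\<exists>\<delta>' F'. admissible \<delta>' F' \<and> e \<in> F' \<and> refines n K (\<delta>, F) (\<delta>', F')"
proof (cases "e \<in> F")
  case True
  then show ?thesis using adm by (intro exI[of _ \<delta>] exI[of _ F]) (simp add: refines_def)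
next
  case False
  obtain m where eE: "e + \<delta> e \<in> E" and
    m: "\<And>b. b \<in> E \<Longrightarrow> agree m (e + \<delta> e) b \<Longrightarrow> e \<in> A \<longleftrightarrow> b \<in> B \<Longrightarrow>
      \<exists>\<delta>'. admissible \<delta>' (insert e F) \<and> e + \<delta>' e = b \<and> refines n K (\<delta>, F) (\<delta>', insert e F)"
    using redirect_near[OF adm e False K, of n] e agree_refl by metis
  obtain b where "b \<in> E" "agree m (e + \<delta> e) b" "e \<in> A \<longleftrightarrow> b \<in> B"
    using B_dense[OF eE, of m] coB_dense[OF eE, of m] B_subset by (cases "e \<in> A") auto
  then show ?thesis using m by blast
qed

lemma extend_range:
  assumes adm: "admissible \<delta> F" and e: "e \<in> E" and K: "seq_closed K" "K \<inter> E = {}"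
  shows "\<exists>\<delta>' F'. admissible \<delta>' F' \<and> (\<exists>x\<in>F'. x + \<delta>' x = e) \<and> refines n K (\<delta>, F) (\<delta>', F')"
proof (cases "\<exists>x\<in>F. x + \<delta> x = e")
  case True
  then show ?thesis using adm by (intro exI[of _ \<delta>] exI[of _ F]) (simp add: refines_def)
next
  case False
  obtain x where x: "x + \<delta> x = e"
    using displacement_surj adm unfolding admissible_def by blast
  then have xF: "x \<notin> F" using False by blast
  then have "\<delta> x \<in> shifts" using adm unfolding admissible_def by (metis agree_refl)
  moreover have "x = e + - \<delta> x" using x by (simp add: fun_eq_iff) (metis add_diff_cancel_right')
  ultimately have xE: "x \<in> E" using shift_E[OF e] shifts_uminus by metis
  obtain m where m: "\<And>a. a \<in> E \<Longrightarrow> agree m x a \<Longrightarrow> a \<in> A \<longleftrightarrow> e \<in> B \<Longrightarrow>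
      \<exists>\<delta>'. admissible \<delta>' (insert a F) \<and> a + \<delta>' a = e \<and> refines n K (\<delta>, F) (\<delta>', insert a F)"
    using redirect_near[OF adm xE xF K, of n] e x agree_refl by metis
  obtain a where "a \<in> E" "agree m x a" "a \<in> A \<longleftrightarrow> e \<in> B"
    using A_dense[OF xE, of m] coA_dense[OF xE, of m] A_subset by (cases "e \<in> B") auto
  then show ?thesis using m by blast
qed

text \<open>
  Forth and back for the \<open>n\<close>-th point of \<open>E\<close>, while the map and its inverse are kept on \<open>K n\<close>.
  The approximations converge uniformly, since step \<open>n\<close> preserves the first \<open>n\<close> coordinates of all
  displacements.  As \<open>K n\<close> misses \<open>E\<close>, the displacement on it has been frozen as an element of
  \<open>shifts\<close>.
\<close>

theorem ex_displacement:
  assumes E: "countable E" "E \<noteq> {}"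
    and K: "\<And>n. seq_closed (K n)" "\<And>n. K n \<inter> E = {}" "\<And>n. K n \<subseteq> K (Suc n)"
  shows "\<exists>\<delta>. strictly_causal \<delta> \<and> (\<lambda>x. x + \<delta> x) ` A = B \<and> (\<lambda>x. x + \<delta> x) ` E = E \<and>
    (\<forall>n x. x \<in> K n \<or> x + \<delta> x \<in> K n \<longrightarrow> \<delta> x \<in> shifts)"
proof -
  define e where "e = from_nat_into E"
  have e: "e n \<in> E" for n unfolding e_def using E(2) by (rule from_nat_into)
  have e_surj: "\<exists>n. e n = x" if "x \<in> E" for x
    unfolding e_def by (rule from_nat_into_surj[OF E(1) that])
  have step: "\<exists>s'. admissible (fst s') (snd s') \<and> (e n \<in> snd s' \<and>
      (\<exists>x\<in>snd s'. x + fst s' x = e n) \<and> refines n (K n) s s')"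
    if adm: "admissible (fst s) (snd s)" for s n
  proof -
    obtain \<delta>1 F1 where 1: "admissible \<delta>1 F1" "e n \<in> F1" "refines n (K n) s (\<delta>1, F1)"
      using extend_domain[OF adm e[of n] K(1)[of n] K(2)[of n], of n] by auto
    obtain \<delta>2 F2 where 2: "admissible \<delta>2 F2" "\<exists>x\<in>F2. x + \<delta>2 x = e n"
        "refines n (K n) (\<delta>1, F1) (\<delta>2, F2)"
      using extend_range[OF 1(1) e[of n] K(1)[of n] K(2)[of n], of n] by auto
    have "e n \<in> F2" using 1(2) 2(3) by (auto simp: refines_def)
    then show ?thesis using 1 2 refines_trans by (intro exI[of _ "(\<delta>2, F2)"]) auto
  qed
  have "admissible (\<lambda>x. 0) {}"
    using shifts_zero by (auto simp: admissible_def strictly_causal_def)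
  then have "\<exists>s. admissible (fst s) (snd s)"
    by (intro exI[of _ "(\<lambda>x. 0, {})"]) simp
  then have "\<exists>s. \<forall>n. admissible (fst (s n)) (snd (s n)) \<and> (e n \<in> snd (s (Suc n)) \<and>
      (\<exists>x\<in>snd (s (Suc n)). x + fst (s (Suc n)) x = e n) \<and> refines n (K n) (s n) (s (Suc n)))"
    by (rule dependent_nat_choice[where P = "\<lambda>n s. admissible (fst s) (snd s)" and
        Q = "\<lambda>n s s'. e n \<in> snd s' \<and> (\<exists>x\<in>snd s'. x + fst s' x = e n) \<and> refines n (K n) s s'"])
      (rule step)
  then obtain s where adm: "\<And>n. admissible (fst (s n)) (snd (s n))"
    and s: "\<And>n. e n \<in> snd (s (Suc n))" "\<And>n. \<exists>x\<in>snd (s (Suc n)). x + fst (s (Suc n)) x = e n"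
      "\<And>n. refines n (K n) (s n) (s (Suc n))"
    by blast
  define \<delta> where "\<delta> x i = fst (s (Suc i)) x i" for x i
  have coord: "fst (s m) x i = fst (s (Suc i)) x i" if "Suc i \<le> m" for m i x
    using that
  proof (induction m rule: dec_induct)
    case (step m)
    then show ?case using s(3)[of m] by (simp add: refines_def agree_def)
  qed simp
  have lim: "agree n (\<delta> x) (fst (s n) x)" for n x
    unfolding agree_def \<delta>_def by (intro allI impI coord[symmetric] Suc_leI)
  have stable: "\<delta> x = fst (s n) x"
    if "x \<in> snd (s n) \<or> x \<in> K n \<or> x + fst (s n) x \<in> K n" for x n
  proof -
    have *: "fst (s m) x = fst (s n) x \<and> (x \<in> snd (s m) \<or> x \<in> K m \<or> x + fst (s m) x \<in> K m)"
      if "n \<le> m" for m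
      using that
    proof (induction m rule: dec_induct)
      case base
      show ?case using \<open>x \<in> snd (s n) \<or> x \<in> K n \<or> x + fst (s n) x \<in> K n\<close> by blast
    next
      case (step m)
      have eq: "fst (s (Suc m)) x = fst (s m) x"
        using s(3)[of m] step.IH unfolding refines_def by blast
      have "snd (s m) \<subseteq> snd (s (Suc m))" using s(3)[of m] by (simp add: refines_def)
      then show ?case unfolding eq using step.IH K(3)[of m] by blast
    qed
    show ?thesis
    proof
      fix i
      have "\<delta> x i = fst (s (n + Suc i)) x i"
        unfolding \<delta>_def by (rule coord[symmetric]) simp
      also have "\<dots> = fst (s n) x i"
        using conjunct1[OF *[of "n + Suc i"]] by (metis le_add1)
      finally show "\<delta> x i = fst (s n) x i" .
    qed
  qed
  have causal: "strictly_causal \<delta>"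
    unfolding strictly_causal_def
  proof (intro allI impI)
    fix x y :: "nat \<Rightarrow> int" and m
    assume xy: "agree m x y"
    have "agree (Suc m) (fst (s (Suc m)) x) (fst (s (Suc m)) y)"
      using adm strictly_causalD[OF _ xy] unfolding admissible_def by blast
    then show "agree (Suc m) (\<delta> x) (\<delta> y)"
      using lim[of "Suc m" x] lim[of "Suc m" y] agree_trans agree_sym by metis
  qed
  have onF: "\<delta> x = fst (s n) x" "x + \<delta> x \<in> E" "x \<in> A \<longleftrightarrow> x + \<delta> x \<in> B" "x \<in> E"
    if "x \<in> snd (s n)" for x n
  proof -
    show "\<delta> x = fst (s n) x" using that stable by blast
    then show "x + \<delta> x \<in> E" "x \<in> A \<longleftrightarrow> x + \<delta> x \<in> B" "x \<in> E"
      using adm[of n] that unfolding admissible_def by auto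
  qed
  have E_into: "x + \<delta> x \<in> E \<and> (x \<in> A \<longleftrightarrow> x + \<delta> x \<in> B)" if "x \<in> E" for x
  proof -
    obtain n where "e n = x" using e_surj[OF \<open>x \<in> E\<close>] by blast
    then have "x \<in> snd (s (Suc n))" using s(1)[of n] by simp
    then show ?thesis using onF(2,3)[of x "Suc n"] by blast
  qed
  have E_onto: "\<exists>x\<in>E. x + \<delta> x = y" if "y \<in> E" for y
  proof -
    obtain n where n: "e n = y" using e_surj[OF \<open>y \<in> E\<close>] by blast
    obtain x where x: "x \<in> snd (s (Suc n))" "x + fst (s (Suc n)) x = e n" using s(2) by blast
    show ?thesis using onF(4)[OF x(1)] x(2)[folded onF(1)[OF x(1)]] unfolding n by blast
  qed
  have shift: "fst (s n) x \<in> shifts" if "x \<notin> snd (s n)" for x n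
  proof -
    have "\<exists>u\<in>shifts. \<exists>m. \<forall>y. agree m x y \<longrightarrow> fst (s n) y = u"
      using adm[of n] that by (simp add: admissible_def)
    then show ?thesis using agree_refl by auto
  qed
  have "\<delta> x \<in> shifts" if "x \<in> K n" for n x
  proof -
    have "x \<notin> snd (s n)" using that K(2)[of n] onF(4)[of x n] by blast
    then show ?thesis using shift[of x n] stable[of x n] that by simp
  qed
  moreover have "\<delta> x \<in> shifts" if x: "x + \<delta> x \<in> K n" for n x
  proof -
    have "strictly_causal (fst (s n))" using adm[of n] by (simp add: admissible_def)
    then obtain x' where x': "x' + fst (s n) x' = x + \<delta> x"
      using displacement_surj by blast
    then have st: "\<delta> x' = fst (s n) x'" using stable[of x' n] x by argo
    then have "x' = x" using displacement_inj[OF causal, of x' x] x' by argo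
    moreover have "x \<notin> snd (s n)" using onF(2)[of x n] x K(2)[of n] by blast
    ultimately show ?thesis using st shift[of x n] by simp
  qed
  moreover have "(\<lambda>x. x + \<delta> x) ` E = E" using E_into E_onto by blast
  moreover have "(\<lambda>x. x + \<delta> x) ` A = B"
    using E_into E_onto A_subset B_subset by blast
  ultimately show ?thesis using causal by blast
qed

end

section \<open>Limits along the ends, and escaping from the translations\<close>

definition nth_end :: "nat \<Rightarrow> nat \<Rightarrow> bool" where
  "nth_end = from_nat_into ends"

lemma nth_end_in: "nth_end n \<in> ends"
  unfolding nth_end_def using ends_dense by (intro from_nat_into) blast

lemma nth_end_surj: "p \<in> ends \<Longrightarrow> \<exists>n. nth_end n = p"
  unfolding nth_end_def by (rule from_nat_into_surj[OF countable_ends])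

lemma nth_end_dense: "\<exists>n. agree M x (nth_end n)"
  using ends_dense nth_end_surj by metis

text \<open>
  A function \<open>\<sigma>\<close> on the (enumerated) ends need not come from a function on a larger set;
  \<open>limit_from_ends \<sigma> x y\<close> says that its values tend to \<open>y\<close> as the ends tend to \<open>x\<close>.
\<close>

definition limit_from_ends :: "(nat \<Rightarrow> nat \<Rightarrow> bool) \<Rightarrow> (nat \<Rightarrow> bool) \<Rightarrow> (nat \<Rightarrow> bool) \<Rightarrow> bool" where
  "limit_from_ends \<sigma> x y \<longleftrightarrow> (\<forall>N. \<exists>M. \<forall>n. agree M x (nth_end n) \<longrightarrow> agree N y (\<sigma> n))"

text \<open>
  What is retained of a homeomorphism of the complement that is not the identity: it has limits
  at all ends, and it moves all the ends of some cylinder out of this cylinder.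
\<close>

definition continuous_displacing :: "(nat \<Rightarrow> nat \<Rightarrow> bool) \<Rightarrow> bool" where
  "continuous_displacing \<sigma> \<longleftrightarrow> (\<forall>p\<in>ends. \<exists>y. limit_from_ends \<sigma> p y) \<and>
    (\<exists>c M. \<forall>n. agree M c (nth_end n) \<longrightarrow> \<not> agree M c (\<sigma> n))"

lemma limit_from_ends_near:
  assumes "limit_from_ends \<sigma> x y"
  shows "\<exists>n. agree M x (nth_end n) \<and> agree N y (\<sigma> n)"
proof -
  obtain M' where M': "\<And>n. agree M' x (nth_end n) \<Longrightarrow> agree N y (\<sigma> n)"
    using assms unfolding limit_from_ends_def by meson
  obtain n where n: "agree (max M M') x (nth_end n)" using nth_end_dense by blast
  have "agree M x (nth_end n)" "agree M' x (nth_end n)" by (rule agree_mono[OF n], simp)+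
  then show ?thesis using M' by blast
qed

text \<open>
  Acting as translation by \<open>u\<close> is a relatively closed condition on the points at which the limit
  exists.
\<close>

lemma not_limit_nearby:
  assumes lim: "limit_from_ends \<sigma> (code z) y" and ne: "y \<noteq> code (z + u)"
  shows "\<exists>m. \<forall>z'. agree m z z' \<longrightarrow> \<not> limit_from_ends \<sigma> (code z') (code (z' + u))"
proof -
  obtain N where N: "\<not> agree N y (code (z + u))" using ne not_agree_ex by blast
  obtain M where M: "\<And>n. agree M (code z) (nth_end n) \<Longrightarrow> agree N y (\<sigma> n)"
    using lim unfolding limit_from_ends_def by meson
  have "\<not> limit_from_ends \<sigma> (code z') (code (z' + u))" if z': "agree (max M N) z z'" for z'
  proof
    assume "limit_from_ends \<sigma> (code z') (code (z' + u))"
    then obtain n where n: "agree M (code z') (nth_end n)" "agree N (code (z' + u)) (\<sigma> n)"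
      using limit_from_ends_near by blast
    have "agree M (code z) (code z')"
      by (rule code_agree, rule agree_mono[OF z']) simp
    then have "agree N y (\<sigma> n)" using n(1) M agree_trans by blast
    moreover have "agree N (code (z + u)) (code (z' + u))"
      by (rule code_agree, rule agree_add[OF agree_mono[OF z']]) simp_all
    ultimately show False using N n(2) unfolding agree_def by auto
  qed
  then show ?thesis by blast
qed

text \<open>
  The Baire category theorem for the closed set \<open>K\<close>: countably many relatively nowhere dense sets
  do not cover it.
\<close>

lemma baire_above:
  fixes h :: "nat \<Rightarrow> nat"
  assumes K: "K = {z :: nat \<Rightarrow> int. agree M z0 z \<and> (\<forall>i\<ge>M. int (h i) \<le> \<bar>z i\<bar>)}"
    and z1: "z1 \<in> K"
    and dense: "\<And>z m j. z \<in> K \<Longrightarrow> \<exists>z'\<in>K. agree m z z' \<and> (\<exists>m'. \<forall>z''\<in>K. agree m' z' z'' \<longrightarrow> z'' \<notin> C j)"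
  shows "\<exists>z\<in>K. \<forall>j::nat. z \<notin> C j"
proof -
  have "\<exists>s. \<forall>j. (fst (s j) \<in> K \<and> j \<le> snd (s j)) \<and>
      (agree (snd (s j)) (fst (s j)) (fst (s (Suc j))) \<and> snd (s j) \<le> snd (s (Suc j)) \<and>
       (\<forall>z''\<in>K. agree (snd (s (Suc j))) (fst (s (Suc j))) z'' \<longrightarrow> z'' \<notin> C j))"
  proof (rule dependent_nat_choice)
    show "\<exists>s. fst s \<in> K \<and> (0::nat) \<le> snd s" using z1 by (intro exI[of _ "(z1, 0)"]) simp
    fix s :: "(nat \<Rightarrow> int) \<times> nat" and j
    assume s: "fst s \<in> K \<and> j \<le> snd s"
    obtain z' m' where z': "z' \<in> K" "agree (snd s) (fst s) z'"
      "\<And>z''. z'' \<in> K \<Longrightarrow> agree m' z' z'' \<Longrightarrow> z'' \<notin> C j"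
      using dense[of "fst s" "snd s" j] s by blast
    let ?m = "Suc (max m' (snd s))"
    have "z'' \<notin> C j" if "z'' \<in> K" "agree ?m z' z''" for z''
      by (rule z'(3)[OF that(1)], rule agree_mono[OF that(2)]) simp
    then show "\<exists>s'. (fst s' \<in> K \<and> Suc j \<le> snd s') \<and> (agree (snd s) (fst s) (fst s') \<and>
        snd s \<le> snd s' \<and> (\<forall>z''\<in>K. agree (snd s') (fst s') z'' \<longrightarrow> z'' \<notin> C j))"
      using z' s by (intro exI[of _ "(z', ?m)"]) auto
  qed
  then obtain s where sK: "\<And>j. fst (s j) \<in> K" "\<And>j. j \<le> snd (s j)"
    and step: "\<And>j. agree (snd (s j)) (fst (s j)) (fst (s (Suc j)))" "\<And>j. snd (s j) \<le> snd (s (Suc j))"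
    and C: "\<And>j z''. z'' \<in> K \<Longrightarrow> agree (snd (s (Suc j))) (fst (s (Suc j))) z'' \<Longrightarrow> z'' \<notin> C j"
    by blast
  define z where "z i = fst (s (Suc i)) i" for i
  have coh: "agree (snd (s j)) (fst (s j)) (fst (s k))" if "j \<le> k" for j k
    using that
  proof (induction k rule: dec_induct)
    case (step k)
    have "snd (s j) \<le> snd (s k)" using step.hyps(1) \<open>\<And>j. snd (s j) \<le> snd (s (Suc j))\<close>
      by (rule lift_Suc_mono_le[rotated])
    then have "agree (snd (s j)) (fst (s k)) (fst (s (Suc k)))"
      by (rule agree_mono[OF \<open>\<And>j. agree (snd (s j)) (fst (s j)) (fst (s (Suc j)))\<close>])
    then show ?case using step.IH agree_trans by blast
  qed simp
  have lim: "agree (snd (s j)) (fst (s j)) z" for j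
    unfolding agree_def
  proof (intro allI impI)
    fix i assume i: "i < snd (s j)"
    have "fst (s j) i = fst (s (max j (Suc i))) i"
      using coh[of j "max j (Suc i)"] i by (simp add: agree_def)
    also have "\<dots> = fst (s (Suc i)) i"
      using coh[of "Suc i" "max j (Suc i)"] sK(2)[of "Suc i"] by (simp add: agree_def)
    finally show "fst (s j) i = z i" by (simp add: z_def)
  qed
  have "int (h i) \<le> \<bar>z i\<bar>" if "M \<le> i" for i
    using sK(1)[of "Suc i"] that by (simp add: K z_def)
  moreover have "agree M z0 z"
    using sK(1)[of M] agree_mono[OF lim[of M] sK(2)] agree_trans by (auto simp: K)
  ultimately have "z \<in> K" by (simp add: K)
  moreover have "z \<notin> C j" for j using C[OF \<open>z \<in> K\<close> lim] .
  ultimately show ?thesis by blast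
qed

text \<open>
  Suppose that \<open>\<sigma>\<close> acts as some translation at every point \<open>z\<close> of the displaced cylinder that
  lies above \<open>h\<close>.  These \<open>z\<close> form a closed set \<open>K\<close>, so by Baire category and
  \<open>not_limit_nearby\<close> a single \<open>u\<close> works for all \<open>z\<close> in a relatively open part of
  \<open>K\<close>, and \<open>u\<close> is not \<open>0\<close>, because \<open>\<sigma>\<close> displaces the cylinder.  Vary a coordinate
  \<open>n\<close> at which \<open>u\<close> does not vanish: as it tends to infinity outside \<open>spikes\<close>, which is
  possible within \<open>K\<close>, the codes tend to an end, whereas the translated codes have two limits,
  depending on whether the translation leads into \<open>spikes\<close> or not.  This contradicts the continuity
  of \<open>\<sigma>\<close> at this end.  Being bounded below by \<open>h\<close> does not restrict the argument, which is why
  \<open>z\<close> can be found above any given function.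
\<close>

lemma ex_not_translation:
  fixes h :: "nat \<Rightarrow> nat"
  assumes good: "continuous_displacing \<sigma>"
  shows "\<exists>z. (\<forall>\<^sub>F i in sequentially. int (h i) \<le> \<bar>z i\<bar>) \<and>
    (\<forall>u\<in>shifts. \<not> limit_from_ends \<sigma> (code z) (code (z + u)))"
proof -
  obtain c M where disp: "\<And>n. agree M c (nth_end n) \<Longrightarrow> \<not> agree M c (\<sigma> n)"
    using good unfolding continuous_displacing_def by blast
  obtain z0 where z0: "agree M c (code z0)" using code_dense by blast
  define K where "K = {z. agree M z0 z \<and> (\<forall>i\<ge>M. int (h i) \<le> \<bar>z i\<bar>)}"
  have K_code: "agree M c (code z)" if "z \<in> K" for z
    using that z0 code_agree[of M z0 z] agree_trans by (auto simp: K_def)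
  have K_ev: "\<forall>\<^sub>F i in sequentially. int (h i) \<le> \<bar>z i\<bar>" if "z \<in> K" for z
    using that unfolding eventually_sequentially K_def by blast
  have no_fix: "\<not> limit_from_ends \<sigma> (code z) (code z)" if z: "z \<in> K" for z
  proof
    assume "limit_from_ends \<sigma> (code z) (code z)"
    then obtain n where n: "agree M (code z) (nth_end n)" "agree M (code z) (\<sigma> n)"
      using limit_from_ends_near by blast
    have "agree M c (nth_end n)" "agree M c (\<sigma> n)"
      by (rule agree_trans[OF K_code[OF z] n(1)], rule agree_trans[OF K_code[OF z] n(2)])
    then show False using disp by blast
  qed
  have not_locally: "\<exists>z'\<in>K. agree m z z' \<and> \<not> limit_from_ends \<sigma> (code z') (code (z' + u))"
    if z: "z \<in> K" and u: "u \<in> shifts" for z u m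
  proof (rule ccontr)
    assume "\<not> ?thesis"
    then have lim: "limit_from_ends \<sigma> (code z') (code (z' + u))" if "z' \<in> K" "agree m z z'" for z'
      using that by blast
    have "u \<noteq> 0" using lim[OF z] no_fix[OF z] by auto
    then obtain i where "u i \<noteq> 0" by (auto simp: fun_eq_iff)
    then obtain n where n: "n \<ge> max m M" "u n \<noteq> 0"
      using shifts_nonzero_infinitely_often[OF u] by blast
    obtain p where p: "p \<in> ends" and
      conv: "\<And>N. \<exists>B. \<forall>z'. agree n z z' \<and> z' n \<notin> spikes \<and> \<bar>z' n\<bar> \<ge> B \<longrightarrow> agree N p (code z')"
      using code_tendsto_end[of n z] by blast
    obtain y where y: "limit_from_ends \<sigma> p y" using good p unfolding continuous_displacing_def by blast
    \<comment> \<open>the position of the bit that tells the two limits of the translated codes apart\<close>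
    define L where "L = block_start (z + u) n"
    obtain N where N: "\<And>k. agree N p (nth_end k) \<Longrightarrow> agree (Suc L) y (\<sigma> k)"
      using y unfolding limit_from_ends_def by meson
    obtain B where B: "\<And>z'. agree n z z' \<Longrightarrow> z' n \<notin> spikes \<Longrightarrow> \<bar>z' n\<bar> \<ge> B \<Longrightarrow> agree N p (code z')"
      using conv[of N] by blast
    have bit: "y L \<longleftrightarrow> q + u n \<in> spikes" if q: "\<bar>q\<bar> \<ge> max B (int (h n))" "q \<notin> spikes" for q
    proof -
      define z' where "z' = z(n := q)"
      have zz': "agree n z z'" by (simp add: z'_def agree_def)
      have "agree M z0 z'"
        using z n agree_mono[OF zz', of M] agree_trans by (auto simp: K_def)
      then have "z' \<in> K" using z q by (auto simp: K_def z'_def)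
      moreover have "agree m z z'" by (rule agree_mono[OF zz']) (use n in simp)
      ultimately have "limit_from_ends \<sigma> (code z') (code (z' + u))" by (rule lim)
      then obtain k where k: "agree N (code z') (nth_end k)" "agree (Suc L) (code (z' + u)) (\<sigma> k)"
        using limit_from_ends_near by blast
      have "agree N p (code z')" using B[OF zz'] q by (simp add: z'_def)
      then have "agree (Suc L) y (\<sigma> k)" using N agree_trans[OF _ k(1)] by blast
      then have "y L = code (z' + u) L" using k(2) by (simp add: agree_def)
      moreover have "L = block_start (z' + u) n"
        unfolding L_def by (rule block_start_agree[OF agree_add[OF zz' agree_refl]]) simp
      ultimately show ?thesis using code_header[of "z' + u" n] by (simp add: z'_def)
    qed
    obtain q where "\<bar>q\<bar> \<ge> max B (int (h n))" "q \<notin> spikes" "q + u n \<notin> spikes"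
      using not_spike_shift_not_spike by blast
    moreover obtain q' where "\<bar>q'\<bar> \<ge> max B (int (h n))" "q' \<notin> spikes" "q' + u n \<in> spikes"
      using not_spike_shift_spike[OF n(2)] by blast
    ultimately show False using bit[of q] bit[of q'] by blast
  qed
  show ?thesis
  proof (rule ccontr)
    assume no: "\<not> ?thesis"
    have ex: "\<exists>u\<in>shifts. limit_from_ends \<sigma> (code z) (code (z + u))" if "z \<in> K" for z
      using no K_ev[OF that] by blast
    define v where "v = from_nat_into shifts"
    have v: "v j \<in> shifts" for j
      unfolding v_def using shifts_zero by (intro from_nat_into) blast
    define C where "C j = {z. limit_from_ends \<sigma> (code z) (code (z + v j))}" for j
    have "\<exists>z\<in>K. \<forall>j. z \<notin> C j"
    proof (rule baire_above[OF K_def])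
      show "(\<lambda>i. if i < M then z0 i else int (h i)) \<in> K" by (simp add: K_def agree_def)
      fix z m j assume "z \<in> K"
      then obtain z' where z': "z' \<in> K" "agree m z z'" "\<not> limit_from_ends \<sigma> (code z') (code (z' + v j))"
        using not_locally v by blast
      obtain u where u: "limit_from_ends \<sigma> (code z') (code (z' + u))" using ex z'(1) by blast
      then have "code (z' + u) \<noteq> code (z' + v j)" using z'(3) by auto
      then obtain m' where "\<And>z''. agree m' z' z'' \<Longrightarrow> z'' \<notin> C j"
        using not_limit_nearby[OF u] unfolding C_def by blast
      then show "\<exists>z'\<in>K. agree m z z' \<and> (\<exists>m'. \<forall>z''\<in>K. agree m' z' z'' \<longrightarrow> z'' \<notin> C j)"
        using z' by blast
    qed
    then obtain z where z: "z \<in> K" "\<And>j. z \<notin> C j" by blast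
    obtain u where u: "u \<in> shifts" "limit_from_ends \<sigma> (code z) (code (z + u))" using ex z(1) by blast
    obtain j where "v j = u"
      unfolding v_def using from_nat_into_surj[OF countable_shifts u(1)] by blast
    then show False using z(2)[of j] u(2) by (simp add: C_def)
  qed
qed

section \<open>The transfinite construction\<close>

definition translates :: "(nat \<Rightarrow> int) set \<Rightarrow> (nat \<Rightarrow> int) set" where
  "translates Z = (\<Union>w\<in>Z. (\<lambda>u. w + u) ` shifts)"

lemma translates_add: "x \<in> translates Z \<Longrightarrow> u \<in> shifts \<Longrightarrow> x + u \<in> translates Z"
  unfolding translates_def using shifts_add by (fastforce simp: add.assoc)

lemma subset_translates: "Z \<subseteq> translates Z"
proof
  fix w assume "w \<in> Z"
  moreover have "w = w + 0" by simp
  ultimately show "w \<in> translates Z"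
    unfolding translates_def using shifts_zero by blast
qed

lemma translates_diffD: "w + u \<in> translates Z \<Longrightarrow> u \<in> shifts \<Longrightarrow> w \<in> translates Z"
  using translates_add[OF _ shifts_uminus, of "w + u" Z u] by simp

lemma countable_translates: "countable Z \<Longrightarrow> countable (translates Z)"
  unfolding translates_def using countable_shifts by auto

lemma translates_lesspoll:
  assumes "Z \<prec> (UNIV :: (nat \<Rightarrow> bool) set)"
  shows "translates Z \<prec> (UNIV :: (nat \<Rightarrow> bool) set)"
proof -
  have "translates Z \<subseteq> (\<lambda>(w, j). w + from_nat_into shifts j) ` (Z \<times> UNIV)"
    unfolding translates_def using from_nat_into_surj[OF countable_shifts] by fastforce
  then have "translates Z \<lesssim> Z \<times> (UNIV :: nat set)"
    by (meson image_lepoll lepoll_trans subset_imp_lepoll)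
  then show ?thesis using Times_nat_lesspoll[OF assms] lesspoll_trans1 by blast
qed

text \<open>
  The form in which Martin's Axiom is used: the bound may take care of all elements of
  \<open>shifts\<close> at once, as there are only countably many.
\<close>

lemma MA_imp_dominated:
  fixes g :: "'a \<Rightarrow> (nat \<Rightarrow> int) \<Rightarrow> nat \<Rightarrow> int"
  assumes MA: "MA_sigma_centered" and I: "I \<prec> (UNIV :: (nat \<Rightarrow> bool) set)"
  shows "\<exists>h :: nat \<Rightarrow> nat. \<forall>a\<in>I. \<forall>u\<in>shifts. \<forall>\<^sub>F i in sequentially. \<bar>g a u i\<bar> < int (h i)"
proof -
  define F where "F = (\<lambda>(a, j) i. Suc (nat \<bar>g a (from_nat_into shifts j) i\<bar>)) ` (I \<times> (UNIV :: nat set))"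
  have "F \<prec> (UNIV :: (nat \<Rightarrow> bool) set)"
    unfolding F_def by (rule lesspoll_trans1[OF image_lepoll Times_nat_lesspoll[OF I]])
  then obtain h where h: "\<And>f. f \<in> F \<Longrightarrow> \<forall>\<^sub>F i in sequentially. f i \<le> h i"
    using MA_imp_eventually_bounded[OF MA] by blast
  have "\<forall>\<^sub>F i in sequentially. \<bar>g a u i\<bar> < int (h i)" if a: "a \<in> I" and u: "u \<in> shifts" for a u
  proof -
    obtain j where j: "from_nat_into shifts j = u"
      using from_nat_into_surj[OF countable_shifts u] by blast
    have "(\<lambda>i. Suc (nat \<bar>g a u i\<bar>)) \<in> F"
      unfolding F_def using a j by (intro image_eqI[of _ _ "(a, j)"]) auto
    from h[OF this] show ?thesis by (rule eventually_mono) auto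
  qed
  then show ?thesis by blast
qed

text \<open>
  One step of the recursion.  The earlier stages have selected the points of \<open>Z\<close>, put the orbits of
  those in \<open>Kept\<close> into the set under construction, and promised to keep the points of \<open>Y\<close> out of
  its image.  The new point \<open>z\<close> is put in if \<open>b\<close> holds, and \<open>y\<close> is the new point to be kept
  out; it equals \<open>code z\<close> if \<open>b\<close> fails.  The purpose is to prevent \<open>\<sigma>\<close> from being a
  homeomorphism of the complement, with \<open>z\<close> above all functions of \<open>H\<close>.
\<close>

definition stage where
  "stage \<sigma> H Z Kept Y b z y \<longleftrightarrow>
    (\<forall>f\<in>H. \<forall>u\<in>shifts. \<forall>\<^sub>F i in sequentially. int (f i) < \<bar>(z + u) i\<bar>) \<and>
    z \<notin> translates Z \<and>
    code ` translates {z} \<inter> Y = {} \<and>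
    y \<notin> code ` translates Kept \<and>
    (b \<longrightarrow> y \<notin> code ` translates {z}) \<and>
    (continuous_displacing \<sigma> \<longrightarrow>
      (if b then limit_from_ends \<sigma> (code z) y
       else y = code z \<and> (\<forall>v. limit_from_ends \<sigma> (code z) v \<longrightarrow> v \<in> code ` translates Kept))) \<and>
    (\<not> continuous_displacing \<sigma> \<longrightarrow> b)"

text \<open>
  A point that eventually exceeds a suitable function meets all requirements that concern \<open>z\<close>
  alone, and \<open>ex_not_translation\<close> provides one whose limit under \<open>\<sigma>\<close>, if there is any, is
  outside of its orbit.  If that limit exists and has not yet been put in, it is kept out and \<open>z\<close>
  is put in; otherwise \<open>z\<close> is kept out.
\<close>

lemma ex_stage:
  fixes H :: "(nat \<Rightarrow> nat) set"
  assumes MA: "MA_sigma_centered"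
    and H: "H \<prec> (UNIV :: (nat \<Rightarrow> bool) set)"
    and Z: "Z \<prec> (UNIV :: (nat \<Rightarrow> bool) set)"
    and Y: "Y \<prec> (UNIV :: (nat \<Rightarrow> bool) set)"
    and Kept: "Kept \<subseteq> Z"
  shows "\<exists>b z y. stage \<sigma> H Z Kept Y b z y"
proof -
  obtain h1 :: "nat \<Rightarrow> nat" where h1:
    "\<And>f u. f \<in> H \<Longrightarrow> u \<in> shifts \<Longrightarrow> \<forall>\<^sub>F i in sequentially. \<bar>int (f i) + \<bar>u i\<bar>\<bar> < int (h1 i)"
    using MA_imp_dominated[OF MA H, of "\<lambda>f u i. int (f i) + \<bar>u i\<bar>"] by blast
  obtain h2 :: "nat \<Rightarrow> nat" where h2:
    "\<And>w u. w \<in> Z \<Longrightarrow> u \<in> shifts \<Longrightarrow> \<forall>\<^sub>F i in sequentially. \<bar>w i + u i\<bar> < int (h2 i)"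
    using MA_imp_dominated[OF MA Z, of "\<lambda>w u i. w i + u i"] by blast
  obtain h3 :: "nat \<Rightarrow> nat" where h3:
    "\<And>v u. v \<in> Y \<Longrightarrow> u \<in> shifts \<Longrightarrow> \<forall>\<^sub>F i in sequentially. \<bar>inv code v i - u i\<bar> < int (h3 i)"
    using MA_imp_dominated[OF MA Y, of "\<lambda>v u i. inv code v i - u i"] by blast
  define h where "h i = h1 i + h2 i + h3 i" for i
  have basic: "(\<forall>f\<in>H. \<forall>u\<in>shifts. \<forall>\<^sub>F i in sequentially. int (f i) < \<bar>(z + u) i\<bar>) \<and>
      z \<notin> translates Z \<and> code ` translates {z} \<inter> Y = {}"
    if z: "\<forall>\<^sub>F i in sequentially. int (h i) \<le> \<bar>z i\<bar>" for z
  proof (intro conjI ballI)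
    fix f u assume "f \<in> H" "u \<in> shifts"
    from h1[OF this] z show "\<forall>\<^sub>F i in sequentially. int (f i) < \<bar>(z + u) i\<bar>"
      by eventually_elim (simp add: h_def)
  next
    show "z \<notin> translates Z"
    proof
      assume "z \<in> translates Z"
      then obtain w u where w: "w \<in> Z" "u \<in> shifts" and zw: "z = w + u"
        unfolding translates_def by blast
      from h2[OF w] z have "\<forall>\<^sub>F i in sequentially. False"
        by eventually_elim (simp add: h_def zw)
      then show False by simp
    qed
    show "code ` translates {z} \<inter> Y = {}"
    proof (rule ccontr)
      assume "\<not> ?thesis"
      then obtain u where u: "u \<in> shifts" "code (z + u) \<in> Y"
        unfolding translates_def by blast
      from h3[OF u(2,1)] z have "\<forall>\<^sub>F i in sequentially. False"
        by eventually_elim (simp add: h_def inv_f_f[OF inj_code])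
      then show False by simp
    qed
  qed
  show ?thesis
  proof (cases "continuous_displacing \<sigma>")
    case False
    have z: "\<forall>\<^sub>F i in sequentially. int (h i) \<le> \<bar>int (h i)\<bar>" by simp
    have "nth_end 0 \<notin> range code" using nth_end_in[of 0] code_not_ends by auto
    then have "stage \<sigma> H Z Kept Y True (\<lambda>i. int (h i)) (nth_end 0)"
      unfolding stage_def using basic[OF z] False by auto
    then show ?thesis by blast
  next
    case True
    obtain z where z: "\<forall>\<^sub>F i in sequentially. int (h i) \<le> \<bar>z i\<bar>"
      and nt: "\<And>u. u \<in> shifts \<Longrightarrow> \<not> limit_from_ends \<sigma> (code z) (code (z + u))"
      using ex_not_translation[OF True, of h] by blast
    note b = basic[OF z]
    show ?thesis
    proof (cases "\<exists>y. limit_from_ends \<sigma> (code z) y \<and> y \<notin> code ` translates Kept")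
      case 2: True
      then obtain y where y: "limit_from_ends \<sigma> (code z) y" "y \<notin> code ` translates Kept" by blast
      have "y \<notin> code ` translates {z}" using nt y(1) unfolding translates_def by blast
      then have "stage \<sigma> H Z Kept Y True z y"
        unfolding stage_def using b y True by simp
      then show ?thesis by blast
    next
      case 2: False
      have "translates Kept \<subseteq> translates Z" using Kept unfolding translates_def by blast
      then have "code z \<notin> code ` translates Kept" using b inj_code by (auto dest: injD)
      then have "stage \<sigma> H Z Kept Y False z (code z)"
        unfolding stage_def using b 2 True by auto
      then show ?thesis by blast
    qed
  qed
qed

text \<open>
  The initial ordinal of the continuum.
\<close>

lemma ex_small_wellorder:
  "\<exists>R :: ((nat \<Rightarrow> bool) \<times> (nat \<Rightarrow> bool)) set. wf R \<and>
    (\<forall>\<alpha> \<beta>. \<alpha> = \<beta> \<or> (\<alpha>, \<beta>) \<in> R \<or> (\<beta>, \<alpha>) \<in> R) \<and>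
    (\<forall>\<alpha>. {\<beta>. (\<beta>, \<alpha>) \<in> R} \<prec> (UNIV :: (nat \<Rightarrow> bool) set))"
proof -
  define r where "r = card_of (UNIV :: (nat \<Rightarrow> bool) set)"
  have wo: "well_order_on UNIV r" unfolding r_def by (rule card_of_well_order_on)
  have "wf (r - Id)" using wo by (simp add: well_order_on_def)
  moreover have "\<alpha> = \<beta> \<or> (\<alpha>, \<beta>) \<in> r - Id \<or> (\<beta>, \<alpha>) \<in> r - Id" for \<alpha> \<beta>
    using wo by (auto simp: well_order_on_def linear_order_on_def total_on_def)
  moreover have "{\<beta>. (\<beta>, \<alpha>) \<in> r - Id} \<prec> (UNIV :: (nat \<Rightarrow> bool) set)" for \<alpha>
  proof -
    have Field: "Field r = UNIV" using well_order_on_Field[OF wo] by simp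
    have "Card_order r" unfolding r_def by (rule card_of_Card_order)
    then have less: "(card_of (underS r \<alpha>), r) \<in> ordLess"
      by (rule card_of_underS) (simp add: Field)
    have "{\<beta>. (\<beta>, \<alpha>) \<in> r - Id} = underS r \<alpha>" by (auto simp: underS_def)
    moreover have "\<not> underS r \<alpha> \<approx> (UNIV :: (nat \<Rightarrow> bool) set)"
      using less not_ordLess_ordIso unfolding eqpoll_def card_of_ordIso r_def by blast
    ultimately show ?thesis by (simp add: lesspoll_def subset_imp_lepoll)
  qed
  ultimately show ?thesis by (intro exI[of _ "r - Id"]) blast
qed

text \<open>
  Every pair of a function to be dominated and a map on the ends is treated at some stage; stages
  are indexed by 0-1 sequences, which can encode such pairs.
\<close>

lemma ex_tasks:
  "\<exists>(\<phi> :: (nat \<Rightarrow> bool) \<Rightarrow> nat \<Rightarrow> nat) (\<psi> :: (nat \<Rightarrow> bool) \<Rightarrow> nat \<Rightarrow> nat \<Rightarrow> bool).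
    \<forall>f \<sigma>. \<exists>\<alpha>. \<phi> \<alpha> = f \<and> \<psi> \<alpha> = \<sigma>"
proof -
  define \<phi> where "\<phi> \<alpha> i = (LEAST j. \<alpha> (prod_encode (0, prod_encode (i, j))))" for \<alpha> :: "nat \<Rightarrow> bool" and i
  define \<psi> where "\<psi> \<alpha> i j = \<alpha> (prod_encode (1, prod_encode (i, j)))" for \<alpha> :: "nat \<Rightarrow> bool" and i j
  have "\<exists>\<alpha>. \<phi> \<alpha> = f \<and> \<psi> \<alpha> = \<sigma>" for f \<sigma>
  proof -
    define \<alpha> where "\<alpha> k = (case prod_decode k of (t, m) \<Rightarrow> case prod_decode m of (i, j) \<Rightarrow>
      if t = 0 then f i = j else \<sigma> i j)" for k
    have "\<phi> \<alpha> i = f i" for i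
      unfolding \<phi>_def by (rule Least_equality) (auto simp: \<alpha>_def)
    moreover have "\<psi> \<alpha> i j = \<sigma> i j" for i j
      by (simp add: \<psi>_def \<alpha>_def)
    ultimately show ?thesis by (intro exI[of _ \<alpha>]) (simp add: fun_eq_iff)
  qed
  then show ?thesis by blast
qed

lemma insert_lesspoll_nat_bool:
  assumes "A \<prec> (UNIV :: (nat \<Rightarrow> bool) set)"
  shows "insert a A \<prec> (UNIV :: (nat \<Rightarrow> bool) set)"
proof (cases "A = {}")
  case True
  then show ?thesis by (intro countable_lesspoll_nat_bool) simp
next
  case False
  then have "insert a A \<subseteq> (\<lambda>(x, j). if j = 0 then a else x) ` (A \<times> (UNIV :: nat set))"
    by (force intro: image_eqI[of _ _ "(_, Suc 0)"])
  then have "insert a A \<lesssim> A \<times> (UNIV :: nat set)"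
    by (meson image_lepoll lepoll_trans subset_imp_lepoll)
  then show ?thesis using Times_nat_lesspoll[OF assms] lesspoll_trans1 by blast
qed

text \<open>
  Stages with this task put their point in unconditionally, which makes the set unbounded.
\<close>

lemma nth_end_not_displacing: "\<not> continuous_displacing nth_end"
  unfolding continuous_displacing_def using nth_end_dense by blast

text \<open>
  The first three properties yield homogeneity, the last one rigidity.  The third one says that
  all but fewer than continuum many points are eventually above \<open>h\<close>: the exceptions are in
  orbits selected before the stage that is responsible for \<open>h\<close>.
\<close>

theorem ex_invariant_scale:
  assumes MA: "MA_sigma_centered"
  obtains X where "\<And>x u. x \<in> X \<Longrightarrow> u \<in> shifts \<Longrightarrow> x + u \<in> X"
    and "\<And>h :: nat \<Rightarrow> nat. \<exists>x\<in>X. \<forall>\<^sub>F i in sequentially. int (h i) < \<bar>x i\<bar>"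
    and "\<And>h :: nat \<Rightarrow> nat. \<exists>L. L \<prec> (UNIV :: (nat \<Rightarrow> bool) set) \<and>
      (\<forall>x\<in>X - L. \<forall>\<^sub>F i in sequentially. int (h i) < \<bar>x i\<bar>)"
    and "\<And>\<sigma>. continuous_displacing \<sigma> \<Longrightarrow>
      (\<exists>z\<in>X. \<exists>y. y \<notin> code ` X \<and> limit_from_ends \<sigma> (code z) y) \<or>
      (\<exists>z. z \<notin> X \<and> (\<forall>v. limit_from_ends \<sigma> (code z) v \<longrightarrow> v \<in> code ` X))"
proof -
  obtain R :: "((nat \<Rightarrow> bool) \<times> (nat \<Rightarrow> bool)) set" where wf: "wf R"
    and total: "\<And>\<alpha> \<beta>. \<alpha> = \<beta> \<or> (\<alpha>, \<beta>) \<in> R \<or> (\<beta>, \<alpha>) \<in> R"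
    and small: "\<And>\<alpha>. {\<beta>. (\<beta>, \<alpha>) \<in> R} \<prec> (UNIV :: (nat \<Rightarrow> bool) set)"
    using ex_small_wellorder by blast
  obtain \<phi> \<psi> where task: "\<And>(f :: nat \<Rightarrow> nat) (\<sigma> :: nat \<Rightarrow> nat \<Rightarrow> bool).
      \<exists>\<alpha> :: nat \<Rightarrow> bool. \<phi> \<alpha> = f \<and> \<psi> \<alpha> = \<sigma>"
    using ex_tasks by blast
  define below where "below \<alpha> = {\<beta>. (\<beta>, \<alpha>) \<in> R}" for \<alpha>
  define P where "P G \<alpha> r \<longleftrightarrow> stage (\<psi> \<alpha>) (\<phi> ` insert \<alpha> (below \<alpha>))
      ((\<lambda>\<beta>. fst (snd (G \<beta>))) ` below \<alpha>) ((\<lambda>\<beta>. fst (snd (G \<beta>))) ` {\<beta>\<in>below \<alpha>. fst (G \<beta>)})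
      ((\<lambda>\<beta>. snd (snd (G \<beta>))) ` below \<alpha>) (fst r) (fst (snd r)) (snd (snd r))"
    for G :: "(nat \<Rightarrow> bool) \<Rightarrow> bool \<times> (nat \<Rightarrow> int) \<times> (nat \<Rightarrow> bool)" and \<alpha> r
  have "\<exists>G. \<forall>\<alpha>. P G \<alpha> (G \<alpha>)"
  proof (rule dependent_wf_choice[OF wf])
    fix G G' :: "(nat \<Rightarrow> bool) \<Rightarrow> bool \<times> (nat \<Rightarrow> int) \<times> (nat \<Rightarrow> bool)" and \<alpha> r
    assume "\<And>\<beta>. (\<beta>, \<alpha>) \<in> R \<Longrightarrow> G \<beta> = G' \<beta>"
    then have eq: "G \<beta> = G' \<beta>" if "\<beta> \<in> below \<alpha>" for \<beta> using that by (simp add: below_def)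
    have 1: "(\<lambda>\<beta>. fst (snd (G \<beta>))) ` below \<alpha> = (\<lambda>\<beta>. fst (snd (G' \<beta>))) ` below \<alpha>"
      and 2: "(\<lambda>\<beta>. fst (snd (G \<beta>))) ` {\<beta>\<in>below \<alpha>. fst (G \<beta>)} =
        (\<lambda>\<beta>. fst (snd (G' \<beta>))) ` {\<beta>\<in>below \<alpha>. fst (G' \<beta>)}"
      and 3: "(\<lambda>\<beta>. snd (snd (G \<beta>))) ` below \<alpha> = (\<lambda>\<beta>. snd (snd (G' \<beta>))) ` below \<alpha>"
      by (rule image_cong; use eq in auto)+
    show "P G \<alpha> r = P G' \<alpha> r" unfolding P_def 1 2 3 ..
  next
    fix \<alpha> and G :: "(nat \<Rightarrow> bool) \<Rightarrow> bool \<times> (nat \<Rightarrow> int) \<times> (nat \<Rightarrow> bool)"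
    have H: "\<phi> ` insert \<alpha> (below \<alpha>) \<prec> (UNIV :: (nat \<Rightarrow> bool) set)"
      unfolding below_def
      by (rule lesspoll_trans1[OF image_lepoll insert_lesspoll_nat_bool[OF small]])
    have Z: "(\<lambda>\<beta>. fst (snd (G \<beta>))) ` below \<alpha> \<prec> (UNIV :: (nat \<Rightarrow> bool) set)"
      and Y: "(\<lambda>\<beta>. snd (snd (G \<beta>))) ` below \<alpha> \<prec> (UNIV :: (nat \<Rightarrow> bool) set)"
      unfolding below_def by (rule lesspoll_trans1[OF image_lepoll small])+
    obtain b z y where "stage (\<psi> \<alpha>) (\<phi> ` insert \<alpha> (below \<alpha>))
      ((\<lambda>\<beta>. fst (snd (G \<beta>))) ` below \<alpha>) ((\<lambda>\<beta>. fst (snd (G \<beta>))) ` {\<beta>\<in>below \<alpha>. fst (G \<beta>)})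
      ((\<lambda>\<beta>. snd (snd (G \<beta>))) ` below \<alpha>) b z y"
      using ex_stage[OF MA H Z Y, of "(\<lambda>\<beta>. fst (snd (G \<beta>))) ` {\<beta>\<in>below \<alpha>. fst (G \<beta>)}" "\<psi> \<alpha>"]
      by blast
    then show "\<exists>r. P G \<alpha> r" unfolding P_def by (intro exI[of _ "(b, z, y)"]) simp
  qed
  then obtain G where G: "\<And>\<alpha>. P G \<alpha> (G \<alpha>)" by blast
  define b where "b \<alpha> = fst (G \<alpha>)" for \<alpha>
  define z where "z \<alpha> = fst (snd (G \<alpha>))" for \<alpha>
  define y where "y \<alpha> = snd (snd (G \<alpha>))" for \<alpha>
  have st: "stage (\<psi> \<alpha>) (\<phi> ` insert \<alpha> (below \<alpha>)) (z ` below \<alpha>) (z ` {\<beta>\<in>below \<alpha>. b \<beta>})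
      (y ` below \<alpha>) (b \<alpha>) (z \<alpha>) (y \<alpha>)" for \<alpha>
    using G[of \<alpha>] unfolding P_def b_def z_def y_def .
  note st_facts = st[unfolded stage_def]
  define X where "X = translates (z ` {\<alpha>. b \<alpha>})"
  \<comment> \<open>A promise is respected by later stages through the choice of \<open>z\<close>, by the same stage, and
    by the orbits put in earlier through the choice of \<open>y\<close>.\<close>
  have y_notin: "y \<beta> \<notin> code ` X" for \<beta>
  proof
    assume "y \<beta> \<in> code ` X"
    then obtain \<alpha> where \<alpha>: "b \<alpha>" "y \<beta> \<in> code ` translates {z \<alpha>}"
      unfolding X_def translates_def by blast
    consider "(\<beta>, \<alpha>) \<in> R" | "\<beta> = \<alpha>" | "(\<alpha>, \<beta>) \<in> R" using total by blast
    then show False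
    proof cases
      case 1
      then have "y \<beta> \<in> y ` below \<alpha>" by (simp add: below_def)
      moreover have "code ` translates {z \<alpha>} \<inter> y ` below \<alpha> = {}" using st_facts[of \<alpha>] by blast
      ultimately show False using \<alpha> by blast
    next
      case 2
      then show False using st_facts[of \<alpha>] \<alpha> by blast
    next
      case 3
      then have "translates {z \<alpha>} \<subseteq> translates (z ` {\<alpha>\<in>below \<beta>. b \<alpha>})"
        using \<alpha>(1) by (auto simp: translates_def below_def)
      moreover have "y \<beta> \<notin> code ` translates (z ` {\<alpha>\<in>below \<beta>. b \<alpha>})" using st_facts[of \<beta>] by blast
      ultimately show False using \<alpha>(2) by blast
    qed
  qed
  have dom: "\<forall>\<^sub>F i in sequentially. int (\<phi> \<beta> i) < \<bar>(z \<alpha> + u) i\<bar>"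
    if "\<beta> = \<alpha> \<or> (\<beta>, \<alpha>) \<in> R" "u \<in> shifts" for \<alpha> \<beta> u
  proof -
    have "\<phi> \<beta> \<in> \<phi> ` insert \<alpha> (below \<alpha>)" using that(1) by (auto simp: below_def)
    then show ?thesis using conjunct1[OF st_facts[of \<alpha>]] that(2) by blast
  qed
  have zX: "z \<alpha> \<in> X" if "b \<alpha>" for \<alpha>
    unfolding X_def by (rule subsetD[OF subset_translates]) (use that in blast)
  show ?thesis
  proof (rule that[of X])
    fix x u assume "x \<in> X" "u \<in> shifts"
    then show "x + u \<in> X" unfolding X_def by (rule translates_add)
  next
    fix h :: "nat \<Rightarrow> nat"
    obtain \<alpha> where \<alpha>: "\<phi> \<alpha> = h" "\<psi> \<alpha> = nth_end" using task by blast
    have "b \<alpha>" using st_facts[of \<alpha>] nth_end_not_displacing \<alpha>(2) by simp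
    moreover have "\<forall>\<^sub>F i in sequentially. int (h i) < \<bar>z \<alpha> i\<bar>"
      using dom[of \<alpha> \<alpha> 0] shifts_zero \<alpha>(1) by simp
    ultimately show "\<exists>x\<in>X. \<forall>\<^sub>F i in sequentially. int (h i) < \<bar>x i\<bar>" using zX by blast
  next
    fix h :: "nat \<Rightarrow> nat"
    obtain \<alpha> where \<alpha>: "\<phi> \<alpha> = h" using task by blast
    let ?L = "translates (z ` below \<alpha>)"
    have "?L \<prec> (UNIV :: (nat \<Rightarrow> bool) set)"
      unfolding below_def by (intro translates_lesspoll lesspoll_trans1[OF image_lepoll small])
    moreover have "\<forall>\<^sub>F i in sequentially. int (h i) < \<bar>x i\<bar>" if x: "x \<in> X - ?L" for x
    proof -
      obtain \<beta> u where \<beta>: "b \<beta>" "u \<in> shifts" "x = z \<beta> + u"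
        using x unfolding X_def translates_def by blast
      have "\<beta> \<notin> below \<alpha>" using x \<beta> unfolding translates_def by blast
      then have "\<alpha> = \<beta> \<or> (\<alpha>, \<beta>) \<in> R" using total[of \<alpha> \<beta>] by (auto simp: below_def)
      then show ?thesis using dom[of \<alpha> \<beta> u] \<beta> \<alpha> by simp
    qed
    ultimately show "\<exists>L. L \<prec> (UNIV :: (nat \<Rightarrow> bool) set) \<and>
      (\<forall>x\<in>X - L. \<forall>\<^sub>F i in sequentially. int (h i) < \<bar>x i\<bar>)" by blast
  next
    fix \<sigma> assume \<sigma>: "continuous_displacing \<sigma>"
    obtain \<alpha> where \<alpha>: "\<psi> \<alpha> = \<sigma>" using task by blast
    have obstruct: "if b \<alpha> then limit_from_ends \<sigma> (code (z \<alpha>)) (y \<alpha>)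
       else y \<alpha> = code (z \<alpha>) \<and>
         (\<forall>v. limit_from_ends \<sigma> (code (z \<alpha>)) v \<longrightarrow> v \<in> code ` translates (z ` {\<beta>\<in>below \<alpha>. b \<beta>}))"
      using st_facts[of \<alpha>] unfolding \<alpha> by (elim conjE) (erule mp[OF _ \<sigma>])
    show "(\<exists>z\<in>X. \<exists>y. y \<notin> code ` X \<and> limit_from_ends \<sigma> (code z) y) \<or>
      (\<exists>z. z \<notin> X \<and> (\<forall>v. limit_from_ends \<sigma> (code z) v \<longrightarrow> v \<in> code ` X))"
    proof (cases "b \<alpha>")
      case True
      then have "limit_from_ends \<sigma> (code (z \<alpha>)) (y \<alpha>)" using obstruct by simp
      then show ?thesis using zX[OF True] y_notin by blast
    next
      case False
      note obstruct' = obstruct[unfolded if_not_P[OF False]]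
      have "z \<alpha> \<notin> X" using y_notin[of \<alpha>] conjunct1[OF obstruct'] by auto
      moreover have "translates (z ` {\<beta>\<in>below \<alpha>. b \<beta>}) \<subseteq> X"
        unfolding X_def translates_def by blast
      ultimately show ?thesis using conjunct2[OF obstruct'] by blast
    qed
  qed
qed

section \<open>Rigidity of the complement\<close>

text \<open>
  A homeomorphism \<open>h\<close> of the complement that is not the identity restricts to a map on the ends to
  which the assumption applies.  If \<open>code z\<close> is in the image of \<open>X\<close>, but the limit
  \<open>y\<close> there is not, then \<open>y\<close> has a preimage in the complement, and continuity of the inverse
  at \<open>y\<close> identifies this preimage with \<open>code z\<close>.  If \<open>z\<close> is not in \<open>X\<close>, then
  the limit at \<open>code z\<close> is the value of \<open>h\<close>.
\<close>

lemma rigid_complement: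
  assumes obstruct: "\<And>\<sigma>. continuous_displacing \<sigma> \<Longrightarrow>
      (\<exists>z\<in>X. \<exists>y. y \<notin> code ` X \<and> limit_from_ends \<sigma> (code z) y) \<or>
      (\<exists>z. z \<notin> X \<and> (\<forall>v. limit_from_ends \<sigma> (code z) v \<longrightarrow> v \<in> code ` X))"
  shows "rigid (subtopology cantor_space (- code ` X))"
  unfolding rigid_def
proof (intro allI impI ballI)
  fix h x0
  assume "homeomorphic_map (subtopology cantor_space (- code ` X)) (subtopology cantor_space (- code ` X)) h"
  note h = homeomorphic_map_cantorD[OF this]
  assume "x0 \<in> topspace (subtopology cantor_space (- code ` X))"
  then have x0: "x0 \<in> - code ` X" by simp
  define \<sigma> where "\<sigma> n = h (nth_end n)" for n
  have in_Y: "nth_end n \<in> - code ` X" for n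
    using nth_end_in[of n] code_not_ends by auto
  have lim: "limit_from_ends \<sigma> x (h x)" if "x \<in> - code ` X" for x
    unfolding limit_from_ends_def
  proof
    fix N
    obtain M where "\<And>x'. x' \<in> - code ` X \<Longrightarrow> agree M x x' \<Longrightarrow> agree N (h x) (h x')"
      using h(3)[OF \<open>x \<in> - code ` X\<close>, of N] by blast
    then show "\<exists>M. \<forall>n. agree M x (nth_end n) \<longrightarrow> agree N (h x) (\<sigma> n)"
      unfolding \<sigma>_def using in_Y by blast
  qed
  show "h x0 = x0"
  proof (rule ccontr)
    assume "h x0 \<noteq> x0"
    then obtain N where N: "\<not> agree N (h x0) x0" using not_agree_ex by blast
    obtain M where M: "\<And>n. agree M x0 (nth_end n) \<Longrightarrow> agree N (h x0) (\<sigma> n)"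
      using lim[OF x0] unfolding limit_from_ends_def by meson
    have "\<not> agree (max M N) x0 (\<sigma> n)" if n: "agree (max M N) x0 (nth_end n)" for n
    proof
      assume a: "agree (max M N) x0 (\<sigma> n)"
      have "agree M x0 (nth_end n)" by (rule agree_mono[OF n]) simp
      then have "agree N (h x0) (\<sigma> n)" by (rule M)
      moreover have "agree N x0 (\<sigma> n)" by (rule agree_mono[OF a]) simp
      ultimately show False using N by (simp add: agree_def)
    qed
    moreover have "\<exists>y. limit_from_ends \<sigma> p y" if "p \<in> ends" for p
      using nth_end_surj[OF that] in_Y lim by blast
    ultimately have "continuous_displacing \<sigma>" unfolding continuous_displacing_def by blast
    from obstruct[OF this] show False
    proof
      assume "\<exists>z\<in>X. \<exists>y. y \<notin> code ` X \<and> limit_from_ends \<sigma> (code z) y"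
      then obtain z y where z: "z \<in> X" and y: "y \<in> - code ` X" and zy: "limit_from_ends \<sigma> (code z) y" by blast
      from y have "y \<in> h ` (- code ` X)" unfolding h(1) .
      then obtain x where x: "y = h x" "x \<in> - code ` X" by (rule imageE)
      then have "x \<noteq> code z" using z by auto
      then obtain K where K: "\<not> agree K x (code z)" using not_agree_ex by blast
      obtain m where m: "\<And>x'. x' \<in> - code ` X \<Longrightarrow> agree m (h x) (h x') \<Longrightarrow> agree K x x'"
        using h(4)[OF x(2), of K] by blast
      obtain n where n: "agree K (code z) (nth_end n)" "agree m y (\<sigma> n)"
        using limit_from_ends_near[OF zy] by blast
      have "agree K x (nth_end n)" by (rule m[OF in_Y]) (use n x in \<open>simp add: \<sigma>_def\<close>)
      then show False using K n(1) unfolding agree_def by auto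
    next
      assume "\<exists>z. z \<notin> X \<and> (\<forall>v. limit_from_ends \<sigma> (code z) v \<longrightarrow> v \<in> code ` X)"
      then obtain z where z: "z \<notin> X" "\<And>v. limit_from_ends \<sigma> (code z) v \<Longrightarrow> v \<in> code ` X" by blast
      have cz: "code z \<in> - code ` X" using z(1) inj_code by (auto dest: injD)
      then have "h (code z) \<in> code ` X" using z(2) lim by blast
      moreover from cz have "h (code z) \<in> h ` (- code ` X)" by (rule imageI)
      ultimately show False unfolding h(1) by simp
    qed
  qed
qed

section \<open>Countable dense homogeneity\<close>

lemma seq_closed_Un: "seq_closed K \<Longrightarrow> seq_closed L \<Longrightarrow> seq_closed (K \<union> L)"
  unfolding seq_closed_def
proof (intro allI impI)
  fix x
  assume KL: "\<forall>x. x \<notin> K \<longrightarrow> (\<exists>m. \<forall>y. agree m x y \<longrightarrow> y \<notin> K)"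
    "\<forall>x. x \<notin> L \<longrightarrow> (\<exists>m. \<forall>y. agree m x y \<longrightarrow> y \<notin> L)" and x: "x \<notin> K \<union> L"
  obtain m where m: "\<And>y. agree m x y \<Longrightarrow> y \<notin> K" using KL(1) x by blast
  obtain n where n: "\<And>y. agree n x y \<Longrightarrow> y \<notin> L" using KL(2) x by blast
  have "y \<notin> K \<union> L" if "agree (max m n) x y" for y
    using m n agree_mono[OF that, of m] agree_mono[OF that, of n] by simp
  then show "\<exists>m. \<forall>y. agree m x y \<longrightarrow> y \<notin> K \<union> L" by blast
qed

text \<open>
  For \<open>x\<close> outside of \<open>E\<close>, record how long \<open>x\<close> agrees with each of the points of \<open>E\<close>.  If
  \<open>g\<close> eventually bounds these records for all \<open>x\<close> in \<open>L\<close>, then the sets of those points whose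
  records are bounded by \<open>max (g i) n\<close> are as desired.
\<close>

lemma closed_cover_small:
  assumes MA: "MA_sigma_centered" and L: "L \<prec> (UNIV :: (nat \<Rightarrow> bool) set)"
    and E: "countable E" "E \<noteq> ({} :: (nat \<Rightarrow> int) set)"
  shows "\<exists>K :: nat \<Rightarrow> (nat \<Rightarrow> int) set. (\<forall>n. seq_closed (K n)) \<and> (\<forall>n. K n \<inter> E = {}) \<and>
    (\<forall>n. K n \<subseteq> K (Suc n)) \<and> L - E \<subseteq> (\<Union>n. K n)"
proof -
  define e where "e = from_nat_into E"
  have e_surj: "\<exists>i. e i = x" if "x \<in> E" for x
    unfolding e_def by (rule from_nat_into_surj[OF E(1) that])
  have e_in: "e i \<in> E" for i unfolding e_def using E(2) by (rule from_nat_into)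
  have "(\<lambda>x i. first_diff (e i) x) ` L \<prec> (UNIV :: (nat \<Rightarrow> bool) set)"
    by (rule lesspoll_trans1[OF image_lepoll L])
  from MA_imp_eventually_bounded[OF MA this]
  obtain g where g: "\<And>x. x \<in> L \<Longrightarrow> \<forall>\<^sub>F i in sequentially. first_diff (e i) x \<le> g i"
    by (auto simp only: ball_simps)
  define K where "K n = {x. \<forall>i. \<not> agree (Suc (max (g i) n)) (e i) x}" for n
  have "seq_closed (K n)" for n
    unfolding seq_closed_def
  proof (intro allI impI)
    fix x assume "x \<notin> K n"
    then obtain i where i: "agree (Suc (max (g i) n)) (e i) x" by (auto simp: K_def)
    have "y \<notin> K n" if "agree (Suc (max (g i) n)) x y" for y
      using agree_trans[OF i that] by (auto simp: K_def)
    then show "\<exists>m. \<forall>y. agree m x y \<longrightarrow> y \<notin> K n" by blast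
  qed
  moreover have "K n \<inter> E = {}" for n
  proof (rule ccontr)
    assume "K n \<inter> E \<noteq> {}"
    then obtain i where "e i \<in> K n" using e_surj by blast
    then have "\<not> agree (Suc (max (g i) n)) (e i) (e i)" unfolding K_def by blast
    then show False by simp
  qed
  moreover have "K n \<subseteq> K (Suc n)" for n
  proof
    fix x assume x: "x \<in> K n"
    have "\<not> agree (Suc (max (g i) (Suc n))) (e i) x" for i
    proof
      assume a: "agree (Suc (max (g i) (Suc n))) (e i) x"
      have "agree (Suc (max (g i) n)) (e i) x" by (rule agree_mono[OF a]) simp
      then show False using x by (simp add: K_def)
    qed
    then show "x \<in> K (Suc n)" by (simp add: K_def)
  qed
  moreover have "L - E \<subseteq> (\<Union>n. K n)"
  proof
    fix x assume x: "x \<in> L - E"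
    obtain m where m: "\<And>i. i \<ge> m \<Longrightarrow> first_diff (e i) x \<le> g i"
      using g x unfolding eventually_sequentially by blast
    define n where "n = (\<Sum>i<m. first_diff (e i) x)"
    have le: "first_diff (e i) x \<le> max (g i) n" for i
    proof (cases "i < m")
      case True
      then have "first_diff (e i) x \<le> n"
        unfolding n_def by (intro member_le_sum) auto
      then show ?thesis by simp
    next
      case False
      then show ?thesis using m[of i] by simp
    qed
    have "\<not> agree (Suc (max (g i) n)) (e i) x" for i
    proof -
      have "e i \<noteq> x" using e_in[of i] x by blast
      then show ?thesis using agree_iff_first_diff[of "e i" x] le[of i] by simp
    qed
    then show "x \<in> (\<Union>n. K n)" by (auto simp: K_def)
  qed
  ultimately show ?thesis by blast
qed

lemma countable_eventually_bounded:
  fixes E :: "(nat \<Rightarrow> int) set"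
  assumes E: "countable E"
  shows "\<exists>h :: nat \<Rightarrow> nat. \<forall>x\<in>E. \<forall>\<^sub>F i in sequentially. \<bar>x i\<bar> < int (h i)"
proof -
  define h where "h i = Suc (\<Sum>j\<le>i. nat \<bar>from_nat_into E j i\<bar>)" for i
  have "\<forall>\<^sub>F i in sequentially. \<bar>x i\<bar> < int (h i)" if x: "x \<in> E" for x
  proof -
    obtain j where j: "from_nat_into E j = x" using from_nat_into_surj[OF E x] by blast
    have "\<bar>x i\<bar> < int (h i)" if "i \<ge> j" for i
    proof -
      have "nat \<bar>from_nat_into E j i\<bar> \<le> (\<Sum>j\<le>i. nat \<bar>from_nat_into E j i\<bar>)"
        using that by (intro member_le_sum) auto
      then show ?thesis unfolding h_def j by linarith
    qed
    then show ?thesis unfolding eventually_sequentially by blast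
  qed
  then show ?thesis by blast
qed

text \<open>
  If \<open>h\<close> bounds the points of \<open>E\<close>, then the points above \<open>h\<close> are covered by closed sets that
  miss \<open>E\<close>, and the remaining points of \<open>X\<close> are few.
\<close>

lemma closed_cover:
  fixes X E :: "(nat \<Rightarrow> int) set"
  assumes MA: "MA_sigma_centered"
    and scale: "\<And>h :: nat \<Rightarrow> nat. \<exists>L. L \<prec> (UNIV :: (nat \<Rightarrow> bool) set) \<and>
      (\<forall>x\<in>X - L. \<forall>\<^sub>F i in sequentially. int (h i) < \<bar>x i\<bar>)"
    and E: "countable E" "E \<noteq> {}"
  shows "\<exists>K :: nat \<Rightarrow> (nat \<Rightarrow> int) set. (\<forall>n. seq_closed (K n)) \<and> (\<forall>n. K n \<inter> E = {}) \<and>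
    (\<forall>n. K n \<subseteq> K (Suc n)) \<and> X - E \<subseteq> (\<Union>n. K n)"
proof -
  obtain h :: "nat \<Rightarrow> nat" where h: "\<And>x. x \<in> E \<Longrightarrow> \<forall>\<^sub>F i in sequentially. \<bar>x i\<bar> < int (h i)"
    using countable_eventually_bounded[OF E(1)] by blast
  obtain L where L: "L \<prec> (UNIV :: (nat \<Rightarrow> bool) set)"
    and XL: "\<And>x. x \<in> X - L \<Longrightarrow> \<forall>\<^sub>F i in sequentially. int (h i) < \<bar>x i\<bar>"
    using scale[of h] by blast
  obtain K where K: "\<And>n. seq_closed (K n)" "\<And>n. K n \<inter> E = {}" "\<And>n. K n \<subseteq> K (Suc n)"
      "L - E \<subseteq> (\<Union>n. K n)"
    using closed_cover_small[OF MA L E] by blast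
  define J where "J n = {x :: nat \<Rightarrow> int. \<forall>i\<ge>n. int (h i) < \<bar>x i\<bar>}" for n
  have J1: "seq_closed (J n)" for n
    unfolding seq_closed_def
  proof (intro allI impI)
    fix x assume "x \<notin> J n"
    then obtain i where i: "i \<ge> n" "\<not> int (h i) < \<bar>x i\<bar>" by (auto simp: J_def)
    have "y \<notin> J n" if "agree (Suc i) x y" for y
    proof -
      have "x i = y i" using that by (simp add: agree_def)
      then show ?thesis using i by (auto simp: J_def)
    qed
    then show "\<exists>m. \<forall>y. agree m x y \<longrightarrow> y \<notin> J n" by blast
  qed
  have J2: "J n \<inter> E = {}" for n
  proof (rule ccontr)
    assume "J n \<inter> E \<noteq> {}"
    then obtain x where x: "x \<in> J n" "x \<in> E" by blast
    have "\<forall>\<^sub>F i in sequentially. int (h i) < \<bar>x i\<bar>"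
      using x(1) unfolding J_def eventually_sequentially by blast
    with h[OF x(2)] have "\<forall>\<^sub>F i in sequentially. False" by eventually_elim simp
    then show False by simp
  qed
  have J3: "J n \<subseteq> J (Suc n)" for n by (auto simp: J_def)
  have J4: "X - L \<subseteq> (\<Union>n. J n)"
    using XL unfolding J_def eventually_sequentially by blast
  show ?thesis
  proof (intro exI[of _ "\<lambda>n. K n \<union> J n"] conjI allI)
    show "seq_closed (K n \<union> J n)" for n by (rule seq_closed_Un[OF K(1) J1])
    show "(K n \<union> J n) \<inter> E = {}" for n using K(2)[of n] J2[of n] by blast
    show "K n \<union> J n \<subseteq> K (Suc n) \<union> J (Suc n)" for n using K(3)[of n] J3[of n] by blast
    show "X - E \<subseteq> (\<Union>n. K n \<union> J n)" using K(4) J4 by blast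
  qed
qed

text \<open>
  The back-and-forth construction is applied to \<open>A\<close> and \<open>B\<close> inside a countable invariant set
  \<open>E\<close>.  The orbit of an additional point \<open>x0\<close> ensures that \<open>E - A\<close> and \<open>E - B\<close> are dense.
\<close>

lemma homogeneous_scale:
  fixes X :: "(nat \<Rightarrow> int) set"
  assumes MA: "MA_sigma_centered"
    and inv: "\<And>x u. x \<in> X \<Longrightarrow> u \<in> shifts \<Longrightarrow> x + u \<in> X"
    and unbounded: "\<And>h :: nat \<Rightarrow> nat. \<exists>x\<in>X. \<forall>\<^sub>F i in sequentially. int (h i) < \<bar>x i\<bar>"
    and scale: "\<And>h :: nat \<Rightarrow> nat. \<exists>L. L \<prec> (UNIV :: (nat \<Rightarrow> bool) set) \<and>
      (\<forall>x\<in>X - L. \<forall>\<^sub>F i in sequentially. int (h i) < \<bar>x i\<bar>)"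
    and A: "countable A" "A \<subseteq> X" "\<And>x m. x \<in> X \<Longrightarrow> \<exists>a\<in>A. agree m x a"
    and B: "countable B" "B \<subseteq> X" "\<And>x m. x \<in> X \<Longrightarrow> \<exists>b\<in>B. agree m x b"
  shows "\<exists>\<delta>. strictly_causal \<delta> \<and> (\<lambda>x. x + \<delta> x) ` A = B \<and> (\<lambda>x. x + \<delta> x) ` X = X"
proof -
  have "countable (translates (A \<union> B))" using A B by (intro countable_translates) simp
  then obtain h :: "nat \<Rightarrow> nat" where
    h: "\<And>x. x \<in> translates (A \<union> B) \<Longrightarrow> \<forall>\<^sub>F i in sequentially. \<bar>x i\<bar> < int (h i)"
    using countable_eventually_bounded by blast
  obtain x0 where x0: "x0 \<in> X" and x0h: "\<forall>\<^sub>F i in sequentially. int (h i) < \<bar>x0 i\<bar>"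
    using unbounded by blast
  have x0_notin: "x0 \<notin> translates (A \<union> B)"
  proof
    assume "x0 \<in> translates (A \<union> B)"
    from h[OF this] x0h have "\<forall>\<^sub>F i in sequentially. False" by eventually_elim simp
    then show False by simp
  qed
  define E where "E = translates (insert x0 (A \<union> B))"
  have EX: "E \<subseteq> X" unfolding E_def translates_def using A(2) B(2) x0 inv by blast
  have cE: "countable E" unfolding E_def using A(1) B(1) by (intro countable_translates) simp
  have sub: "A \<subseteq> E" "B \<subseteq> E" "x0 \<in> E"
    unfolding E_def using subset_translates[of "insert x0 (A \<union> B)"] by auto
  have co_dense: "\<exists>a\<in>E - (A \<union> B). agree m x a" for x m
  proof -
    obtain u where u: "u \<in> shifts" "agree m (x - x0) u" using shifts_dense by blast
    have "agree m x (x0 + u)" using u(2) by (auto simp: agree_def)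
    moreover have "x0 + u \<in> E" unfolding E_def using translates_add sub(3) u(1) E_def by blast
    moreover have "x0 + u \<notin> A \<union> B"
      using translates_diffD[OF _ u(1), of x0 "A \<union> B"] x0_notin subset_translates by blast
    ultimately show ?thesis by blast
  qed
  interpret back_and_forth A B E
  proof
    show "x + u \<in> E" if "x \<in> E" "u \<in> shifts" for x u
      using that unfolding E_def by (rule translates_add)
  qed (use sub A(3) B(3) EX co_dense in blast)+
  obtain K :: "nat \<Rightarrow> (nat \<Rightarrow> int) set" where K: "\<And>n. seq_closed (K n)" "\<And>n. K n \<inter> E = {}"
      "\<And>n. K n \<subseteq> K (Suc n)" and cover: "X - E \<subseteq> (\<Union>n. K n)"
    using closed_cover[OF MA scale cE] sub(3) by blast
  have "E \<noteq> {}" using sub(3) by blast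
  from ex_displacement[OF cE this, of K, OF K] obtain \<delta> where causal: "strictly_causal \<delta>"
    and AB: "(\<lambda>x. x + \<delta> x) ` A = B" and EE: "(\<lambda>x. x + \<delta> x) ` E = E"
    and shift: "\<And>n x. x \<in> K n \<or> x + \<delta> x \<in> K n \<Longrightarrow> \<delta> x \<in> shifts"
    by blast
  have "(\<lambda>x. x + \<delta> x) ` X = X"
  proof (intro equalityI subsetI)
    fix y assume "y \<in> (\<lambda>x. x + \<delta> x) ` X"
    then obtain x where x: "x \<in> X" "y = x + \<delta> x" by blast
    show "y \<in> X"
    proof (cases "x \<in> E")
      case True
      then have "y \<in> E" using EE x by blast
      then show ?thesis using EX by blast
    next
      case False
      then obtain n where "x \<in> K n" using cover x(1) by blast
      then have "\<delta> x \<in> shifts" using shift by blast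
      then show ?thesis using inv x by simp
    qed
  next
    fix y assume y: "y \<in> X"
    show "y \<in> (\<lambda>x. x + \<delta> x) ` X"
    proof (cases "y \<in> E")
      case True
      then have "y \<in> (\<lambda>x. x + \<delta> x) ` E" using EE by blast
      then show ?thesis using EX by blast
    next
      case False
      then obtain n where n: "y \<in> K n" using cover y by blast
      obtain x where x: "x + \<delta> x = y" using displacement_surj[OF causal] by blast
      then have "\<delta> x \<in> shifts" using shift[of x n] n by simp
      then have "x + \<delta> x + - \<delta> x \<in> X" using inv[OF y shifts_uminus] x by blast
      then have "x \<in> X" by simp
      then show ?thesis using x by blast
    qed
  qed
  then show ?thesis using causal AB by blast
qed

text \<open>
  Conjugation by \<open>code\<close> transports displacements to homeomorphisms of the subspace.
\<close>

lemma homogeneous_code_image: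
  fixes X :: "(nat \<Rightarrow> int) set"
  assumes hom: "\<And>A B. countable A \<Longrightarrow> A \<subseteq> X \<Longrightarrow> (\<And>x m. x \<in> X \<Longrightarrow> \<exists>a\<in>A. agree m x a) \<Longrightarrow>
      countable B \<Longrightarrow> B \<subseteq> X \<Longrightarrow> (\<And>x m. x \<in> X \<Longrightarrow> \<exists>b\<in>B. agree m x b) \<Longrightarrow>
      \<exists>\<delta>. strictly_causal \<delta> \<and> (\<lambda>x. x + \<delta> x) ` A = B \<and> (\<lambda>x. x + \<delta> x) ` X = X"
  shows "countable_dense_homogeneous (subtopology cantor_space (code ` X))"
  unfolding countable_dense_homogeneous_def dense_subset_cantor_iff
proof (intro allI impI)
  fix A B
  assume AB: "countable A \<and> (A \<subseteq> code ` X \<and> (\<forall>x\<in>code ` X. \<forall>n. \<exists>a\<in>A. agree n x a)) \<and>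
    countable B \<and> (B \<subseteq> code ` X \<and> (\<forall>x\<in>code ` X. \<forall>n. \<exists>b\<in>B. agree n x b))"
  have pull: "countable (code -` D)" "code -` D \<subseteq> X" "code ` (code -` D) = D"
      "\<And>x m. x \<in> X \<Longrightarrow> \<exists>d\<in>code -` D. agree m x d"
    if D: "countable D" "D \<subseteq> code ` X" "\<forall>x\<in>code ` X. \<forall>n. \<exists>a\<in>D. agree n x a" for D
  proof -
    have "countable (code ` (code -` D))" by (rule countable_subset[OF _ D(1)]) blast
    then show "countable (code -` D)"
      by (rule countable_image_inj_on) (use inj_code in \<open>auto simp: inj_on_def\<close>)
    show "code -` D \<subseteq> X" using D(2) inj_code by (auto dest: injD)
    show "code ` (code -` D) = D" using D(2) by blast
    fix x m assume "x \<in> X"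
    then obtain d where d: "d \<in> D" "agree (block_start x m) (code x) d" using D(3) by blast
    then obtain d' where "d = code d'" using D(2) by blast
    then show "\<exists>d\<in>code -` D. agree m x d" using d code_agreeD[of x m d'] by blast
  qed
  from AB have A_facts: "countable A" "A \<subseteq> code ` X" "\<forall>x\<in>code ` X. \<forall>n. \<exists>a\<in>A. agree n x a"
    and B_facts: "countable B" "B \<subseteq> code ` X" "\<forall>x\<in>code ` X. \<forall>n. \<exists>b\<in>B. agree n x b"
    by - (elim conjE, assumption)+
  note A = pull[OF A_facts] and B = pull[OF B_facts]
  from hom[OF A(1,2,4) B(1,2,4)]
  obtain \<delta> where causal: "strictly_causal \<delta>"
    and map: "(\<lambda>x. x + \<delta> x) ` (code -` A) = code -` B" "(\<lambda>x. x + \<delta> x) ` X = X"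
    by blast
  define f where "f x = x + \<delta> x" for x
  define h where "h = code \<circ> f \<circ> inv code"
  have h: "h (code x) = code (f x)" for x by (simp add: h_def inv_f_f[OF inj_code])
  have h_image: "h ` code ` D = code ` f ` D" for D unfolding image_image by (simp add: h)
  have f: "f ` (code -` A) = code -` B" "f ` X = X" using map unfolding f_def by simp_all
  have "homeomorphic_map (subtopology cantor_space (code ` X)) (subtopology cantor_space (code ` X)) h"
  proof (rule homeomorphic_map_cantorI)
    show "h ` code ` X = code ` X" unfolding h_image f(2) ..
    show "inj_on h (code ` X)"
    proof (rule inj_onI)
      fix x y assume "x \<in> code ` X" "y \<in> code ` X" and hxy: "h x = h y"
      then obtain v w where vw: "x = code v" "y = code w" by blast
      then have "f v = f w" using hxy injD[OF inj_code, of "f v" "f w"] by (simp only: h)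
      then have "v = w" unfolding f_def by (rule displacement_inj[OF causal])
      then show "x = y" using vw by simp
    qed
  next
    fix x n assume "x \<in> code ` X"
    then obtain w where w: "x = code w" by blast
    have "agree n (h x) (h (code w'))" if "agree (block_start w n) x (code w')" for w'
      using code_agreeD[of w n w'] that displacement_agree_iff[OF causal, of n w w']
      by (simp add: w h f_def code_agree)
    then show "\<exists>m. \<forall>x'\<in>code ` X. agree m x x' \<longrightarrow> agree n (h x) (h x')" by blast
  next
    fix x n assume "x \<in> code ` X"
    then obtain w where w: "x = code w" by blast
    have "agree n x (code w')" if "agree (block_start (f w) n) (h x) (h (code w'))" for w'
      using code_agreeD[of "f w" n "f w'"] that displacement_agree_iff[OF causal, of n w w']
      by (simp add: w h f_def code_agree)
    then show "\<exists>m. \<forall>x'\<in>code ` X. agree m (h x) (h x') \<longrightarrow> agree n x x'" by blast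
  qed
  moreover have "h ` A = B"
    using h_image[of "code -` A"] unfolding f(1) A(3) B(3) .
  ultimately show "\<exists>h. homeomorphic_map (subtopology cantor_space (code ` X))
      (subtopology cantor_space (code ` X)) h \<and> h ` A = B" by blast
qed

theorem theorem8:
  assumes "MA_sigma_centered"
  shows "\<exists>X \<subseteq> topspace cantor_space.
    countable_dense_homogeneous (subtopology cantor_space X) \<and>
    dense_subset cantor_space (topspace cantor_space - X) \<and>
    rigid (subtopology cantor_space (topspace cantor_space - X))"
proof -
  obtain X where inv: "\<And>x u. x \<in> X \<Longrightarrow> u \<in> shifts \<Longrightarrow> x + u \<in> X"
    and unbounded: "\<And>h :: nat \<Rightarrow> nat. \<exists>x\<in>X. \<forall>\<^sub>F i in sequentially. int (h i) < \<bar>x i\<bar>"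
    and scale: "\<And>h :: nat \<Rightarrow> nat. \<exists>L. L \<prec> (UNIV :: (nat \<Rightarrow> bool) set) \<and>
      (\<forall>x\<in>X - L. \<forall>\<^sub>F i in sequentially. int (h i) < \<bar>x i\<bar>)"
    and obstruct: "\<And>\<sigma>. continuous_displacing \<sigma> \<Longrightarrow>
      (\<exists>z\<in>X. \<exists>y. y \<notin> code ` X \<and> limit_from_ends \<sigma> (code z) y) \<or>
      (\<exists>z. z \<notin> X \<and> (\<forall>v. limit_from_ends \<sigma> (code z) v \<longrightarrow> v \<in> code ` X))"
    by (rule ex_invariant_scale[OF assms]) (rule that)
  have "countable_dense_homogeneous (subtopology cantor_space (code ` X))"
    by (rule homogeneous_code_image, rule homogeneous_scale[OF assms inv unbounded scale])
  moreover have "dense_subset cantor_space (UNIV - code ` X)"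
  proof -
    have "\<exists>p\<in>UNIV - code ` X. agree n x p" for x n
      using ends_dense[of n x] code_not_ends by blast
    then show ?thesis
      using dense_subset_cantor_iff[of UNIV "UNIV - code ` X"]
      by (simp add: subtopology_UNIV)
  qed
  moreover have "rigid (subtopology cantor_space (UNIV - code ` X))"
    using rigid_complement[OF obstruct] by (simp add: Compl_eq_Diff_UNIV)
  ultimately show ?thesis by (intro exI[of _ "code ` X"]) simp
qed

end
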